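(* Let $\alpha>\frac12$, $a(x) = c_\alpha(1+|x|^2)^{-\alpha}$ with $\int_{\mathbb{R}}a(x)\,dx=1$, let $0\le u_0\in L^\infty(\mathbb{R})$, and let $u=u(x,t)$ be the corresponding classical solution to $$\frac{\partial u}{\partial t}(x,t) = \min\Big\{\int_{\mathbb{R}} a(x-y)u(y,t)\,dy,\ 1\Big\},\quad x\in\mathbb{R},\ t\in(0,\infty),\qquad u(x,0)=u_0(x),\quad x\in\mathbb{R}.$$ Then for any $\varepsilon\in(0,1)$ and $n\ge1$ there exists $\tau=\tau(\varepsilon,n)$ such that the following inclusions hold. 1. If there exists $C>0$ such that $u_0(x)\le C a(x)$ for $x\in\mathbb{R}$, and there exist $\mu>0$, $x_0\in\mathbb{R}$ such that $u_0(x)\ge\mu$ for $x\in[x_0-\mu,x_0+\mu]$, then for all $t\ge\tau$, $$\{x: u(x,t)\in[\tfrac1n,n]\}\subset\{x: e^{\frac{1-\varepsilon}{2\alpha}t}\le|x|\le e^{\frac{1+\varepsilon}{2\alpha}t}\}.$$ 2. If there exists $C>0$ such that $u_0(x)\le C\int_x^\infty a(y)\,dy$ for $x\in\mathbb{R}$, and there exist $\mu>0$, $\rho\in\mathbb{R}$ such that $u_0(x)\ge\mu$ for $x\le\rho$, then for all $t\ge\tau$, $$\{x: u(x,t)\in[\tfrac1n,n]\}\subset\{x: e^{\frac{1-\varepsilon}{2\alpha-1}t}\le x\le e^{\frac{1+\varepsilon}{2\alpha-1}t}\}.$$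
   Context: A classical solution is a function $u\in C(\mathbb{R}_+,L^\infty(\mathbb{R}))\cap C^1((0,\infty),L^\infty(\mathbb{R}))$ satisfying the equation. Pointwise (in)equalities and set inclusions in $x$ for elements of $L^\infty(\mathbb{R})$ are understood for almost every $x\in\mathbb{R}$. *)

theory Defs
  imports "HOL-Analysis.Analysis" "HOL-Probability.Essential_Supremum"
begin

text \<open>
  Elements of \<open>L\<^sup>\<infinity>(\<real>)\<close> are represented by functions; two functions that agree almost
  everywhere represent the same element.
\<close>

definition Linf :: "(real \<Rightarrow> real) set" where
  "Linf = {f \<in> borel_measurable lebesgue. esssup lebesgue (\<lambda>x. ereal \<bar>f x\<bar>) < \<infinity>}"

definition Linf_norm :: "(real \<Rightarrow> real) \<Rightarrow> real" where
  "Linf_norm f = real_of_ereal (esssup lebesgue (\<lambda>x. ereal \<bar>f x\<bar>))"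

text \<open>
  A function \<open>u(x,t)\<close> is treated as a curve \<open>t \<mapsto> u(\<cdot>,t)\<close> in \<open>L\<^sup>\<infinity>(\<real>)\<close>, so time is the
  first argument of \<open>u\<close>. Continuity and differentiability are with respect to the norm.
\<close>

definition Linf_continuous_on :: "real set \<Rightarrow> (real \<Rightarrow> real \<Rightarrow> real) \<Rightarrow> bool" where
  "Linf_continuous_on T u \<longleftrightarrow>
     (\<forall>t\<in>T. u t \<in> Linf) \<and>
     (\<forall>t\<in>T. ((\<lambda>s. Linf_norm (\<lambda>x. u s x - u t x)) \<longlongrightarrow> 0) (at t within T))"

definition Linf_has_derivative_at ::
    "(real \<Rightarrow> real \<Rightarrow> real) \<Rightarrow> (real \<Rightarrow> real) \<Rightarrow> real \<Rightarrow> bool" where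
  "Linf_has_derivative_at u v t \<longleftrightarrow>
     ((\<lambda>s. Linf_norm (\<lambda>x. (u s x - u t x) / (s - t) - v x)) \<longlongrightarrow> 0) (at t)"

text \<open>
  The function \<open>u'\<close> is the time derivative of \<open>u\<close>; its norm continuity on \<open>(0,\<infinity>)\<close> expresses
  \<open>u \<in> C\<^sup>1((0,\<infinity>), L\<^sup>\<infinity>(\<real>))\<close>.
\<close>

definition classical_solution ::
    "(real \<Rightarrow> real) \<Rightarrow> (real \<Rightarrow> real) \<Rightarrow> (real \<Rightarrow> real \<Rightarrow> real) \<Rightarrow> bool" where
  "classical_solution a u0 u \<longleftrightarrow>
     Linf_continuous_on {0..} u \<and>
     (\<exists>u'. Linf_continuous_on {0<..} u' \<and>
        (\<forall>t>0. Linf_has_derivative_at u (u' t) t) \<and>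
        (\<forall>t>0. AE x in lebesgue. u' t x = min (\<integral>y. a (x - y) * u t y \<partial>lebesgue) 1)) \<and>
     (AE x in lebesgue. u 0 x = u0 x)"

end

theory Submission imports Defs begin

text \<open>
  Both cases compare \<open>u\<close> with rescalings of a profile
  \<open>f R x = (1 + (p x / R)\<^sup>2) powr (- \<beta>)\<close>, where \<open>p x = \<bar>x\<bar>\<close>, \<open>\<beta> = \<alpha>\<close> for localised
  and \<open>p x = max x 0\<close>, \<open>\<beta> = \<alpha> - 1/2\<close> for front-like initial data. Since \<open>p\<close> is
  1-Lipschitz, a slowly varying profile is almost an eigenfunction of the convolution: for every
  \<open>\<delta> > 0\<close> one has \<open>(1 - \<delta>) f R \<le> a * f R\<close> for all large \<open>R\<close>, and
  \<open>a * f R \<le> (1 + \<delta>) f R\<close> for some \<open>R\<close>.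

  Hence \<open>C exp ((1 + \<delta>) t) f R\<close> is a supersolution of the linear equation, and bounds the set
  where \<open>u \<ge> 1/n\<close>. From below, \<open>f S \<le> (S / R) powr (2 \<beta>) f R\<close> for \<open>R \<le> S\<close> shows that
  \<open>\<theta> f (R0 exp (\<gamma> t))\<close> with \<open>2 \<beta> \<gamma> = 1 - 2 \<delta>\<close> is a subsolution bounded by 1; it keeps
  \<open>u\<close> above a fixed small level where \<open>p x \<le> R0 exp (\<gamma> t)\<close>. From then on the
  time derivative of \<open>u\<close> has a fixed positive lower bound there, so \<open>u\<close> exceeds \<open>n\<close>
  after an additional time that does not depend on \<open>t\<close>.
\<close>

section \<open>Comparison of curves in \<open>L\<^sup>\<infinity>\<close>\<close>

text \<open>Membership in \<open>Linf\<close> is what makes the norm meaningful: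
  \<open>real_of_ereal\<close> sends an infinite essential supremum to 0.\<close>

lemma AE_abs_le_Linf_norm:
  assumes "f \<in> Linf"
  shows "AE x in lebesgue. \<bar>f x\<bar> \<le> Linf_norm f"
proof -
  let ?S = "esssup lebesgue (\<lambda>x. ereal \<bar>f x\<bar>)"
  have ae: "AE x in lebesgue. ereal \<bar>f x\<bar> \<le> ?S" by (rule esssup_AE)
  have "?S < \<infinity>" using assms by (simp add: Linf_def)
  then show ?thesis
    using ae unfolding Linf_norm_def
    by (elim eventually_mono) (cases ?S; auto)
qed

lemma LinfI:
  assumes "f \<in> borel_measurable lebesgue" "AE x in lebesgue. \<bar>f x\<bar> \<le> B"
  shows "f \<in> Linf"
proof -
  have "esssup lebesgue (\<lambda>x. ereal \<bar>f x\<bar>) \<le> ereal B"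
    using assms by (intro esssup_I) auto
  then show ?thesis using assms by (auto simp: Linf_def)
qed

lemma Linf_measurable: "f \<in> Linf \<Longrightarrow> f \<in> borel_measurable lebesgue"
  by (simp add: Linf_def)

lemma Linf_diff:
  assumes "f \<in> Linf" "g \<in> Linf"
  shows "(\<lambda>x. f x - g x) \<in> Linf"
proof (rule LinfI)
  show "(\<lambda>x. f x - g x) \<in> borel_measurable lebesgue"
    using assms by (intro borel_measurable_diff Linf_measurable)
  show "AE x in lebesgue. \<bar>f x - g x\<bar> \<le> Linf_norm f + Linf_norm g"
    using AE_abs_le_Linf_norm[OF assms(1)] AE_abs_le_Linf_norm[OF assms(2)]
    by eventually_elim linarith
qed

lemma Linf_divide:
  assumes "f \<in> Linf"
  shows "(\<lambda>x. f x / r) \<in> Linf"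
proof (rule LinfI)
  show "(\<lambda>x. f x / r) \<in> borel_measurable lebesgue"
    using assms by (auto dest: Linf_measurable)
  show "AE x in lebesgue. \<bar>f x / r\<bar> \<le> Linf_norm f / \<bar>r\<bar>"
    using AE_abs_le_Linf_norm[OF assms(1)]
    by eventually_elim (simp add: divide_right_mono)
qed

text \<open>The norm limits are unfolded into almost everywhere estimates, so that the comparison
  argument can work pointwise in \<open>x\<close>. Only right difference quotients are kept, since
  that argument moves forward in time. As for a classical solution, continuity includes the initial
  time while the derivative exists only after it.\<close>

definition AE_differentiable_curve ::
    "real \<Rightarrow> (real \<Rightarrow> real \<Rightarrow> real) \<Rightarrow> (real \<Rightarrow> real \<Rightarrow> real) \<Rightarrow> bool" where
  "AE_differentiable_curve t0 z z' \<longleftrightarrow>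
     (\<forall>t\<ge>t0. \<forall>e>0. \<exists>d>0. \<forall>s\<ge>t0. \<bar>s - t\<bar> < d \<longrightarrow>
        (AE x in lebesgue. \<bar>z s x - z t x\<bar> \<le> e)) \<and>
     (\<forall>t>t0. \<forall>e>0. \<exists>d>0. \<forall>h. 0 < h \<and> h < d \<longrightarrow>
        (AE x in lebesgue. \<bar>z (t + h) x - z t x - h * z' t x\<bar> \<le> e * h))"

lemma AE_differentiable_curve_shift:
  assumes "AE_differentiable_curve t0 z z'" "t0 \<le> t1"
  shows "AE_differentiable_curve t1 z z'"
  unfolding AE_differentiable_curve_def
proof (intro conjI allI impI)
  fix t e :: real assume "t1 \<le> t" "0 < e"
  then obtain d where "d > 0" "\<forall>s\<ge>t0. \<bar>s - t\<bar> < d \<longrightarrow> (AE x in lebesgue. \<bar>z s x - z t x\<bar> \<le> e)"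
    using assms unfolding AE_differentiable_curve_def by (meson order_trans)
  then show "\<exists>d>0. \<forall>s\<ge>t1. \<bar>s - t\<bar> < d \<longrightarrow> (AE x in lebesgue. \<bar>z s x - z t x\<bar> \<le> e)"
    using assms(2) by (meson order_trans)
next
  fix t e :: real assume "t1 < t" "0 < e"
  then show "\<exists>d>0. \<forall>h. 0 < h \<and> h < d \<longrightarrow>
      (AE x in lebesgue. \<bar>z (t + h) x - z t x - h * z' t x\<bar> \<le> e * h)"
    using assms unfolding AE_differentiable_curve_def by (meson order_le_less_trans)
qed

text \<open>Lets the comparison from below serve for upper bounds too, by applying it to
  \<open>- u\<close>.\<close>

lemma AE_differentiable_curve_minus:
  assumes "AE_differentiable_curve t0 z z'"
  shows "AE_differentiable_curve t0 (\<lambda>t x. - z t x) (\<lambda>t x. - z' t x)"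
proof -
  have 1: "\<bar>- b - - a\<bar> = \<bar>b - a\<bar>" for a b :: real by simp
  have 2: "\<bar>- p - - q - h * - r\<bar> = \<bar>p - q - h * r\<bar>" for p q r h :: real
    by (simp add: abs_if)
  show ?thesis
    using assms unfolding AE_differentiable_curve_def 1 2 .
qed

lemma classical_solution_curve:
  assumes "classical_solution a u0 u"
  obtains u' where "AE_differentiable_curve 0 u u'"
    "\<And>t. t > 0 \<Longrightarrow> AE x in lebesgue. u' t x = min (\<integral>y. a (x - y) * u t y \<partial>lebesgue) 1"
    "\<And>t. t \<ge> 0 \<Longrightarrow> u t \<in> Linf"
    "AE x in lebesgue. u 0 x = u0 x"
proof -
  obtain u' where u': "Linf_continuous_on {0<..} u'"
      and der: "\<And>t. t > 0 \<Longrightarrow> Linf_has_derivative_at u (u' t) t"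
      and eq: "\<And>t. t > 0 \<Longrightarrow> AE x in lebesgue. u' t x = min (\<integral>y. a (x - y) * u t y \<partial>lebesgue) 1"
      and cont: "Linf_continuous_on {0..} u" and "AE x in lebesgue. u 0 x = u0 x"
    using assms unfolding classical_solution_def by blast
  have uL: "u t \<in> Linf" if "t \<ge> 0" for t
    using cont that by (auto simp: Linf_continuous_on_def)
  have u'L: "u' t \<in> Linf" if "t > 0" for t
    using u' that by (auto simp: Linf_continuous_on_def)
  have "AE_differentiable_curve 0 u u'"
    unfolding AE_differentiable_curve_def
  proof (intro conjI allI impI)
    fix t e :: real assume t: "0 \<le> t" and e: "0 < e"
    have "((\<lambda>s. Linf_norm (\<lambda>x. u s x - u t x)) \<longlongrightarrow> 0) (at t within {0..})"
      using cont t by (auto simp: Linf_continuous_on_def)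
    from order_tendstoD(2)[OF this e]
    obtain d where d: "d > 0" and
      *: "\<And>s. s \<ge> 0 \<Longrightarrow> s \<noteq> t \<Longrightarrow> \<bar>s - t\<bar> < d \<Longrightarrow> Linf_norm (\<lambda>x. u s x - u t x) < e"
      by (auto simp: eventually_at dist_real_def)
    show "\<exists>d>0. \<forall>s\<ge>0. \<bar>s - t\<bar> < d \<longrightarrow> (AE x in lebesgue. \<bar>u s x - u t x\<bar> \<le> e)"
    proof (intro exI[of _ d] conjI d allI impI)
      fix s assume s: "0 \<le> s" "\<bar>s - t\<bar> < d"
      show "AE x in lebesgue. \<bar>u s x - u t x\<bar> \<le> e"
      proof (cases "s = t")
        case True then show ?thesis using e by simp
      next
        case False
        show ?thesis
          using AE_abs_le_Linf_norm[OF Linf_diff[OF uL[OF s(1)] uL[OF t]]]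
          by eventually_elim (use *[OF s(1) False s(2)] in linarith)
      qed
    qed
  next
    fix t e :: real assume t: "0 < t" and e: "0 < e"
    have "((\<lambda>s. Linf_norm (\<lambda>x. (u s x - u t x) / (s - t) - u' t x)) \<longlongrightarrow> 0) (at t)"
      using der[OF t] by (simp add: Linf_has_derivative_at_def)
    from order_tendstoD(2)[OF this e]
    obtain d where d: "d > 0" and
      *: "\<And>s. s \<noteq> t \<Longrightarrow> \<bar>s - t\<bar> < d \<Longrightarrow>
            Linf_norm (\<lambda>x. (u s x - u t x) / (s - t) - u' t x) < e"
      by (auto simp: eventually_at dist_real_def)
    show "\<exists>d>0. \<forall>h. 0 < h \<and> h < d \<longrightarrow>
        (AE x in lebesgue. \<bar>u (t + h) x - u t x - h * u' t x\<bar> \<le> e * h)"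
    proof (intro exI[of _ d] conjI d allI impI)
      fix h assume h: "0 < h \<and> h < d"
      have L: "(\<lambda>x. (u (t + h) x - u t x) / (t + h - t) - u' t x) \<in> Linf"
        using t h by (intro Linf_diff Linf_divide uL u'L) auto
      have "Linf_norm (\<lambda>x. (u (t + h) x - u t x) / (t + h - t) - u' t x) < e"
        using h by (intro *) auto
      with AE_abs_le_Linf_norm[OF L]
      have "AE x in lebesgue. \<bar>(u (t + h) x - u t x) / h - u' t x\<bar> \<le> e"
        by (auto elim: eventually_mono)
      then show "AE x in lebesgue. \<bar>u (t + h) x - u t x - h * u' t x\<bar> \<le> e * h"
      proof eventually_elim
        case (elim x)
        have "u (t + h) x - u t x - h * u' t x = ((u (t + h) x - u t x) / h - u' t x) * h"
          using h by (simp add: field_simps)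
        then show ?case
          using elim h by (simp add: abs_mult mult_right_mono)
      qed
    qed
  qed
  then show ?thesis by (rule that) fact+
qed

text \<open>
  The error \<open>V - z\<close> is kept below the barrier \<open>e * exp (2 * (t - t0))\<close>; its rate 2 pays
  for the growth \<open>M\<close> of the error and for the error of the difference quotient of \<open>z\<close>.
\<close>

lemma AE_comparison:
  fixes z z' V k :: "real \<Rightarrow> real \<Rightarrow> real"
  assumes z: "AE_differentiable_curve t0 z z'"
    and init: "AE x in lebesgue. V t0 x \<le> z t0 x"
    and \<rho>: "\<rho> > 0"
    and V: "\<And>t h x. t \<ge> t0 \<Longrightarrow> 0 < h \<Longrightarrow> h < \<rho> \<Longrightarrow> V (t + h) x \<le> V t x + h * k t x"
    and k: "\<And>t x. t \<ge> t0 \<Longrightarrow> k t x \<le> 1"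
    and key: "\<And>t M. t > t0 \<Longrightarrow> M \<ge> 0 \<Longrightarrow> AE x in lebesgue. V t x \<le> z t x + M \<Longrightarrow>
                AE x in lebesgue. k t x \<le> z' t x + M"
    and t: "t \<ge> t0"
  shows "AE x in lebesgue. V t x \<le> z t x"
proof -
  have cont: "\<exists>d>0. \<forall>s\<ge>t0. \<bar>s - t\<bar> < d \<longrightarrow> (AE x in lebesgue. \<bar>z s x - z t x\<bar> \<le> e)"
    if "t \<ge> t0" "e > 0" for t e
    using z that unfolding AE_differentiable_curve_def by blast
  have der: "\<exists>d>0. \<forall>h. 0 < h \<and> h < d \<longrightarrow>
       (AE x in lebesgue. \<bar>z (t + h) x - z t x - h * z' t x\<bar> \<le> e * h)"
    if "t > t0" "e > 0" for t e
    using z that unfolding AE_differentiable_curve_def by blast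
  \<comment> \<open>Since \<open>k \<le> 1\<close>, the lower curve \<open>V\<close> cannot jump
    upwards. This replaces continuity of \<open>V\<close> in the limit from the left and at the
    initial time.\<close>
  have step: "V (t + h) x \<le> V t x + h" if "t \<ge> t0" "0 < h" "h < \<rho>" for t h x
  proof -
    have "h * k t x \<le> h * 1" using that by (intro mult_left_mono k) auto
    then show ?thesis using V[OF that, of x] by simp
  qed
  have barrier: "AE x in lebesgue. V t x \<le> z t x + e * exp (2 * (t - t0))"
    if e: "e > 0" and t: "t \<ge> t0" for e t
  proof (rule ccontr)
    \<comment> \<open>Let \<open>m\<close> be the infimum of the times at which the barrier fails.
      The barrier holds at \<open>m\<close> by a limit from the left, and it persists on an interval
      to the right of \<open>m\<close>, which contradicts the choice of \<open>m\<close>.\<close>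
    define P where "P t \<longleftrightarrow> (AE x in lebesgue. V t x \<le> z t x + e * exp (2 * (t - t0)))" for t
    define S where "S = {t. t \<ge> t0 \<and> \<not> P t}"
    assume "\<not> ?thesis"
    then have ne: "S \<noteq> {}" using t by (auto simp: S_def P_def)
    have bdd: "bdd_below S" by (auto simp: S_def intro!: bdd_belowI[of _ t0])
    define m where "m = Inf S"
    have m: "m \<ge> t0"
      unfolding m_def using ne by (intro cInf_greatest) (auto simp: S_def)
    have left: "P s" if "t0 \<le> s" "s < m" for s
      using that cInf_lower[OF _ bdd, of s] by (force simp: m_def S_def)
    have Pm: "P m"
    proof (cases "m = t0")
      case True
      show ?thesis using init unfolding P_def True
        by eventually_elim (use e in simp)
    next
      case False
      then have mt: "m > t0" using m by simp
      \<comment> \<open>The slack runs over \<open>1 / Suc n\<close> only, so that countably many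
        null sets are discarded. One half pays for the growth of \<open>V\<close> during the short
        time \<open>h\<close>, the other for the change of \<open>z\<close>.\<close>
      have "AE x in lebesgue. V m x \<le> z m x + e * exp (2 * (m - t0)) + 1 / Suc n" for n
      proof -
        obtain d where d: "d > 0"
          and dz: "\<And>s. s \<ge> t0 \<Longrightarrow> \<bar>s - m\<bar> < d \<Longrightarrow>
                     AE x in lebesgue. \<bar>z s x - z m x\<bar> \<le> 1 / (2 * Suc n)"
          using cont[OF m, of "1 / (2 * Suc n)"] by auto
        define h where "h = Min {d / 2, \<rho> / 2, m - t0, 1 / (2 * Suc n)}"
        have h: "0 < h" "h < d" "h < \<rho>" "h \<le> m - t0" "h \<le> 1 / (2 * Suc n)"
          using d \<rho> mt by (auto simp: h_def min_def)
        have 1: "e * exp (2 * (m - h - t0)) \<le> e * exp (2 * (m - t0))" using e h(1) by simp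
        have 2: "V m x \<le> V (m - h) x + h" for x
          using step[of "m - h" h x] h by simp
        have 3: "AE x in lebesgue. V (m - h) x \<le> z (m - h) x + e * exp (2 * (m - h - t0))"
          using left[of "m - h"] h by (simp add: P_def)
        have 4: "AE x in lebesgue. \<bar>z (m - h) x - z m x\<bar> \<le> 1 / (2 * Suc n)"
          using h by (intro dz) auto
        have 5: "1 / real (2 * Suc n) + 1 / real (2 * Suc n) = 1 / Suc n"
          by (simp add: field_simps)
        show ?thesis
          using 3 4 by eventually_elim (use 1 2 5 h(5) in \<open>smt (verit)\<close>)
      qed
      then have "AE x in lebesgue. \<forall>n. V m x \<le> z m x + e * exp (2 * (m - t0)) + 1 / Suc n"
        by (simp add: AE_all_countable)
      then show ?thesis
        unfolding P_def
      proof eventually_elim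
        case (elim x)
        show ?case
        proof (rule field_le_epsilon)
          fix r :: real assume "r > 0"
          then obtain n where "1 / Suc n < r" using nat_approx_posE by blast
          then show "V m x \<le> z m x + e * exp (2 * (m - t0)) + r"
            using elim[rule_format, of n] by linarith
        qed
      qed
    qed
    \<comment> \<open>At \<open>m = t0\<close> no derivative is given, but the initial inequality
      holds without the barrier, so \<open>e\<close> can be split between the changes of
      \<open>V\<close> and \<open>z\<close>. Later, \<open>key\<close> is applied with
      \<open>M\<close> equal to the height of the barrier.\<close>
    have "\<exists>d>0. \<forall>h. 0 < h \<and> h < d \<longrightarrow> P (m + h)"
    proof (cases "m = t0")
      case True
      obtain d where d: "d > 0"
        and dz: "\<And>s. s \<ge> t0 \<Longrightarrow> \<bar>s - m\<bar> < d \<Longrightarrow> AE x in lebesgue. \<bar>z s x - z m x\<bar> \<le> e / 2"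
        using cont[OF m, of "e / 2"] e by auto
      show ?thesis
      proof (intro exI[of _ "Min {d, \<rho>, e / 2}"] conjI allI impI)
        show "0 < Min {d, \<rho>, e / 2}" using d \<rho> e by simp
        fix h assume h: "0 < h \<and> h < Min {d, \<rho>, e / 2}"
        then have 1: "e * 1 \<le> e * exp (2 * (m + h - t0))"
          using e True by (intro mult_left_mono) auto
        have 2: "V (m + h) x \<le> V m x + h" for x
          using step[of m h x] h True by simp
        have 3: "AE x in lebesgue. \<bar>z (m + h) x - z m x\<bar> \<le> e / 2"
          using h True by (intro dz) auto
        have 4: "AE x in lebesgue. V m x \<le> z m x" using init True by simp
        have 5: "h < e / 2" using h by simp
        show "P (m + h)" unfolding P_def
          using 3 4 by eventually_elim (use 1 2 5 in \<open>smt (verit) field_sum_of_halves\<close>)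
      qed
    next
      case False
      then have mt: "m > t0" using m by simp
      define \<phi> where "\<phi> = e * exp (2 * (m - t0))"
      have \<phi>: "\<phi> \<ge> e" "\<phi> > 0" using e mt by (auto simp: \<phi>_def)
      have kz: "AE x in lebesgue. k m x \<le> z' m x + \<phi>"
        using Pm \<phi> by (intro key mt) (auto simp: P_def \<phi>_def)
      obtain d where d: "d > 0"
        and dz: "\<And>h. 0 < h \<Longrightarrow> h < d \<Longrightarrow>
              AE x in lebesgue. \<bar>z (m + h) x - z m x - h * z' m x\<bar> \<le> e * h"
        using der[OF mt e] by auto
      show ?thesis
      proof (intro exI[of _ "min d \<rho>"] conjI allI impI)
        show "0 < min d \<rho>" using d \<rho> by simp
        fix h assume h: "0 < h \<and> h < min d \<rho>"
        have "\<phi> * (1 + 2 * h) \<le> \<phi> * exp (2 * h)"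
          using \<phi> by (intro mult_left_mono) (auto simp: exp_ge_add_one_self)
        also have "\<dots> = e * exp (2 * (m + h - t0))"
          by (simp add: \<phi>_def exp_add[symmetric] algebra_simps)
        finally have grow: "\<phi> + 2 * (h * \<phi>) \<le> e * exp (2 * (m + h - t0))"
          by (simp add: algebra_simps)
        have eh: "e * h \<le> h * \<phi>" using \<phi> h by (simp add: mult.commute)
        have Vz: "AE x in lebesgue. V m x \<le> z m x + \<phi>" using Pm by (simp add: P_def \<phi>_def)
        have zh: "AE x in lebesgue. \<bar>z (m + h) x - z m x - h * z' m x\<bar> \<le> e * h"
          using h by (intro dz) auto
        show "P (m + h)" unfolding P_def
          using kz Vz zh
        proof eventually_elim
          case (elim x)
          have "V (m + h) x \<le> V m x + h * k m x" using h m by (intro V) auto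
          moreover have "h * k m x \<le> h * z' m x + h * \<phi>"
            using mult_left_mono[OF elim(1), of h] h by (simp add: algebra_simps)
          ultimately show ?case using elim grow eh by linarith
        qed
      qed
    qed
    then obtain d where d: "d > 0" "\<And>h. 0 < h \<Longrightarrow> h < d \<Longrightarrow> P (m + h)" by auto
    have "m + d \<le> s" if "s \<in> S" for s
    proof (rule ccontr)
      assume "\<not> m + d \<le> s"
      moreover have "m \<le> s" using cInf_lower[OF that bdd] by (simp add: m_def)
      ultimately have "P s" using d(2)[of "s - m"] Pm by (cases "s = m") auto
      then show False using that by (simp add: S_def)
    qed
    then have "m + d \<le> m" using ne unfolding m_def by (intro cInf_greatest) auto
    then show False using d by simp
  qed
  \<comment> \<open>The barrier is normalised to have height \<open>1 / Suc n\<close> at the fixed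
    final time \<open>t\<close>.\<close>
  have "AE x in lebesgue. V t x \<le> z t x + 1 / Suc n" for n
    using barrier[of "1 / Suc n * exp (- (2 * (t - t0)))" t] t by (simp add: exp_add[symmetric] exp_minus field_simps)
  then have "AE x in lebesgue. \<forall>n. V t x \<le> z t x + 1 / Suc n"
    by (simp add: AE_all_countable)
  then show ?thesis
  proof eventually_elim
    case (elim x)
    show ?case
    proof (rule field_le_epsilon)
      fix r :: real assume "r > 0"
      then obtain n where "1 / Suc n < r" using nat_approx_posE by blast
      then show "V t x \<le> z t x + r" using elim[rule_format, of n] by linarith
    qed
  qed
qed

section \<open>Convolution with the kernel\<close>

text \<open>The affine substitution is made in \<open>lborel\<close>; Borel measurability of
  \<open>g\<close> lets completion carry the result to \<open>lebesgue\<close>.\<close>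

lemma integrable_lebesgue_reflect:
  fixes g :: "real \<Rightarrow> real"
  assumes "g \<in> borel_measurable borel" "integrable lebesgue g"
  shows "integrable lebesgue (\<lambda>y. g (x - y))"
proof -
  have "integrable lborel (\<lambda>y. g (x + (-1) * y))"
    using assms by (intro lborel_integrable_real_affine) (auto simp: integrable_completion)
  then show ?thesis
    using assms by (subst integrable_completion) auto
qed

lemma integral_lebesgue_reflect:
  fixes g :: "real \<Rightarrow> real"
  assumes "g \<in> borel_measurable borel"
  shows "(\<integral>y. g (x - y) \<partial>lebesgue) = (\<integral>y. g y \<partial>lebesgue)"
proof -
  have "(\<integral>y. g (x - y) \<partial>lebesgue) = (\<integral>y. g (x - y) \<partial>lborel)"
    using assms by (intro integral_completion) auto
  also have "\<dots> = (\<integral>y. g y \<partial>lborel)"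
    using lborel_integral_real_affine[of "-1" g x] by simp
  also have "\<dots> = (\<integral>y. g y \<partial>lebesgue)"
    using assms by (intro integral_completion[symmetric]) auto
  finally show ?thesis .
qed

locale power_kernel =
  fixes \<alpha> c :: real and a :: "real \<Rightarrow> real"
  assumes alpha: "\<alpha> > 1/2"
    and a_eq: "a x = c * (1 + \<bar>x\<bar>\<^sup>2) powr (- \<alpha>)"
    and integral_a: "(\<integral>x. a x \<partial>lebesgue) = 1"
begin

lemma a_measurable [measurable]: "a \<in> borel_measurable borel"
proof -
  have "a = (\<lambda>x. c * (1 + \<bar>x\<bar>\<^sup>2) powr (- \<alpha>))" using a_eq by blast
  then show ?thesis by simp
qed

text \<open>A non-integrable function has Bochner integral 0, whereas this integral is 1.\<close>

lemma integrable_a: "integrable lebesgue a"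
  using integral_a not_integrable_integral_eq[of lebesgue a] by fastforce

text \<open>The normalisation decides the sign: for \<open>c \<le> 0\<close> the kernel would have
  nonpositive integral.\<close>

lemma c_pos: "c > 0"
proof (rule ccontr)
  assume "\<not> c > 0"
  then have "a x \<le> 0" for x unfolding a_eq by (simp add: mult_nonpos_nonneg)
  then have "0 \<le> (\<integral>x. - a x \<partial>lebesgue)"
    by (intro Bochner_Integration.integral_nonneg) auto
  then show False using integral_a by simp
qed

lemma a_pos: "a x > 0"
proof -
  have "1 + \<bar>x\<bar>\<^sup>2 > 0" by (simp add: add_pos_nonneg)
  then show ?thesis using c_pos unfolding a_eq by simp
qed

lemma a_nonneg: "a x \<ge> 0"
  using a_pos[of x] by simp

lemma a_antimono:
  assumes "\<bar>y\<bar> \<le> \<bar>z\<bar>"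
  shows "a z \<le> a y"
proof -
  have "(1 + \<bar>z\<bar>\<^sup>2) powr (- \<alpha>) \<le> (1 + \<bar>y\<bar>\<^sup>2) powr (- \<alpha>)"
    using alpha assms by (intro powr_mono2') (auto simp: add_pos_nonneg abs_le_square_iff)
  then show ?thesis using c_pos unfolding a_eq by simp
qed

text \<open>At \<open>z = 0\<close> the bound would fail, because \<open>0 powr r\<close> is
  0.\<close>

lemma a_le: assumes "z \<noteq> 0" shows "a z \<le> c * \<bar>z\<bar> powr (- 2 * \<alpha>)"
proof -
  have "\<bar>z\<bar> powr (- 2 * \<alpha>) = (\<bar>z\<bar> powr 2) powr (- \<alpha>)"
    by (simp only: powr_powr) simp
  also have "\<bar>z\<bar> powr 2 = \<bar>z\<bar>\<^sup>2" using assms by simp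
  finally have "\<bar>z\<bar> powr (- 2 * \<alpha>) = (\<bar>z\<bar>\<^sup>2) powr (- \<alpha>)" .
  moreover have "(1 + \<bar>z\<bar>\<^sup>2) powr (- \<alpha>) \<le> (\<bar>z\<bar>\<^sup>2) powr (- \<alpha>)"
    using assms alpha by (intro powr_mono2') auto
  ultimately show ?thesis using c_pos unfolding a_eq by simp
qed

lemma integrable_conv:
  assumes g: "g \<in> borel_measurable lebesgue" and "AE y in lebesgue. \<bar>g y\<bar> \<le> B"
  shows "integrable lebesgue (\<lambda>y. a (x - y) * g y)"
proof (rule Bochner_Integration.integrable_bound)
  have int: "integrable lebesgue (\<lambda>y. a (x - y))"
    by (intro integrable_lebesgue_reflect integrable_a) simp
  then show "integrable lebesgue (\<lambda>y. B * a (x - y))" by simp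
  show "(\<lambda>y. a (x - y) * g y) \<in> borel_measurable lebesgue"
    using int g by (intro borel_measurable_times) auto
  show "AE y in lebesgue. norm (a (x - y) * g y) \<le> norm (B * a (x - y))"
    using assms(2)
  proof eventually_elim
    case (elim y)
    have "a (x - y) * \<bar>g y\<bar> \<le> a (x - y) * \<bar>B\<bar>"
      using elim by (intro mult_left_mono a_nonneg) auto
    then show ?case using a_nonneg[of "x - y"] by (simp add: abs_mult mult.commute)
  qed
qed

lemma conv_const: "integrable lebesgue (\<lambda>y. a (x - y) * M)" "(\<integral>y. a (x - y) * M \<partial>lebesgue) = M"
  using integrable_lebesgue_reflect[OF a_measurable integrable_a, of x]
    integral_lebesgue_reflect[OF a_measurable, of x] integral_a by auto

text \<open>A constant error passes through the convolution unchanged because \<open>a\<close> has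
  mass 1. This is exactly the growth that the hypothesis \<open>key\<close> of
  \<open>AE_comparison\<close> permits.\<close>

lemma conv_mono:
  assumes "integrable lebesgue (\<lambda>y. a (x - y) * f y)" "integrable lebesgue (\<lambda>y. a (x - y) * g y)"
    "AE y in lebesgue. f y \<le> g y + M"
  shows "(\<integral>y. a (x - y) * f y \<partial>lebesgue) \<le> (\<integral>y. a (x - y) * g y \<partial>lebesgue) + M"
proof -
  have "(\<integral>y. a (x - y) * f y \<partial>lebesgue) \<le> (\<integral>y. a (x - y) * g y + a (x - y) * M \<partial>lebesgue)"
  proof (rule integral_mono_AE[OF assms(1)])
    show "integrable lebesgue (\<lambda>y. a (x - y) * g y + a (x - y) * M)"
      using assms(2) conv_const(1) by (rule Bochner_Integration.integrable_add)
    show "AE y in lebesgue. a (x - y) * f y \<le> a (x - y) * g y + a (x - y) * M"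
      using assms(3)
      by eventually_elim (simp add: distrib_left[symmetric] mult_left_mono a_nonneg)
  qed
  also have "\<dots> = (\<integral>y. a (x - y) * g y \<partial>lebesgue) + M"
    using assms(2) conv_const[of x M] by simp
  finally show ?thesis .
qed

lemma integrable_a_indicator:
  assumes "S \<in> sets borel"
  shows "integrable lebesgue (\<lambda>z. a z * indicator S z)"
  using assms by (intro integrable_real_mult_indicator integrable_a sets_completionI_sets) simp

text \<open>All of the integral outside the interval is dropped; inside it the radially decreasing
  kernel is at least \<open>a D\<close>.\<close>

lemma conv_ge_interval:
  assumes g: "g \<in> Linf" "AE y in lebesgue. 0 \<le> g y"
    and \<mu>: "\<mu> \<ge> 0" "AE y in lebesgue. y \<in> {l..r} \<longrightarrow> \<mu> \<le> g y"
    and lr: "l \<le> r" and D: "\<And>y. y \<in> {l..r} \<Longrightarrow> \<bar>x - y\<bar> \<le> D"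
  shows "\<mu> * (r - l) * a D \<le> (\<integral>y. a (x - y) * g y \<partial>lebesgue)"
proof -
  have "\<mu> * (r - l) * a D = (\<integral>y. \<mu> * a D * indicator {l..r} y \<partial>lebesgue)"
    using lr by simp
  also have "\<dots> \<le> (\<integral>y. a (x - y) * g y \<partial>lebesgue)"
  proof (rule integral_mono_AE)
    show "integrable lebesgue (\<lambda>y. \<mu> * a D * indicator {l..r} y)"
      by (intro integrable_mult_right integrable_real_indicator) (auto simp: lr)
    show "integrable lebesgue (\<lambda>y. a (x - y) * g y)"
      using g by (intro integrable_conv[OF Linf_measurable AE_abs_le_Linf_norm])
    show "AE y in lebesgue. \<mu> * a D * indicator {l..r} y \<le> a (x - y) * g y"
      using g(2) \<mu>(2)
    proof eventually_elim
      case (elim y)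
      show ?case
      proof (cases "y \<in> {l..r}")
        case True
        have "a D \<le> a (x - y)" using D[OF True] by (intro a_antimono) auto
        then have "a D * \<mu> \<le> a (x - y) * g y"
          using elim True \<mu>(1) a_nonneg by (intro mult_mono) auto
        then show ?thesis using True by (simp add: mult.commute)
      next
        case False
        then show ?thesis using elim a_nonneg[of "x - y"] by simp
      qed
    qed
  qed
  finally show ?thesis .
qed

lemma central_mass:
  assumes "\<delta> > 0"
  shows "\<exists>A0>0. \<forall>A\<ge>A0. (\<integral>z. a z * indicator {-A..A} z \<partial>lebesgue) \<ge> 1 - \<delta>"
proof -
  have "((\<lambda>A. \<integral>z. a z * indicator {-A..A} z \<partial>lebesgue) \<longlongrightarrow> (\<integral>z. a z \<partial>lebesgue)) at_top"
  proof (rule integral_dominated_convergence_at_top[where w = a])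
    show "a \<in> borel_measurable lebesgue" "integrable lebesgue a"
      using integrable_a by auto
    show "(\<lambda>z. a z * indicator {-A..A} z) \<in> borel_measurable lebesgue" for A :: real
      by (intro borel_measurable_integrable integrable_a_indicator) simp
    show "\<forall>\<^sub>F A in at_top. AE z in lebesgue. norm (a z * indicator {-A..A} z) \<le> a z"
      by (auto simp: a_nonneg indicator_def)
    show "AE z in lebesgue. ((\<lambda>A. a z * indicator {-A..A} z) \<longlongrightarrow> a z) at_top"
    proof (rule AE_I2, rule tendsto_eventually)
      show "\<forall>\<^sub>F A in at_top. a z * indicator {-A..A} z = a z" for z
        using eventually_ge_at_top[of "\<bar>z\<bar>"] by eventually_elim (auto simp: indicator_def)
    qed
  qed
  then have "\<forall>\<^sub>F A in at_top. (\<integral>z. a z * indicator {-A..A} z \<partial>lebesgue) > 1 - \<delta>"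
    using assms by (intro order_tendstoD) (auto simp: integral_a)
  then obtain A0 where "\<And>A. A \<ge> A0 \<Longrightarrow> (\<integral>z. a z * indicator {-A..A} z \<partial>lebesgue) > 1 - \<delta>"
    by (auto simp: eventually_at_top_linorder)
  then show ?thesis by (intro exI[of _ "max A0 1"]) (auto intro: less_imp_le)
qed

text \<open>The pure power that dominates \<open>a\<close> is integrated explicitly. The resulting
  exponent \<open>1 - 2 * \<alpha>\<close> is the decay rate of the front-like profile.\<close>

lemma tail_le:
  assumes "m > 0"
  shows "(\<integral>z. a z * indicator {m..} z \<partial>lebesgue) \<le> c / (2 * \<alpha> - 1) * m powr (1 - 2 * \<alpha>)"
proof -
  have "set_integrable lebesgue {m..} a"
    using integrable_a_indicator[of "{m..}"] by (simp add: set_integrable_def mult.commute)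
  then have 1: "(a has_integral (LINT x:{m..}|lebesgue. a x)) {m..}"
    by (rule has_integral_set_lebesgue)
  have 2: "((\<lambda>x. c * x powr (-2 * \<alpha>)) has_integral c * (-(m powr (-2*\<alpha>+1)) / (-2*\<alpha>+1))) {m..}"
    using alpha assms by (intro has_integral_mult_right has_integral_powr_to_inf) auto
  have "(LINT x:{m..}|lebesgue. a x) \<le> c * (-(m powr (-2*\<alpha>+1)) / (-2*\<alpha>+1))"
  proof (rule has_integral_le[OF 1 2])
    fix x assume "x \<in> {m..}"
    then show "a x \<le> c * x powr (- 2 * \<alpha>)" using a_le[of x] assms by simp
  qed
  also have "\<dots> = c / (2 * \<alpha> - 1) * m powr (1 - 2 * \<alpha>)"
    using alpha by (simp add: field_simps)
  finally show ?thesis by (simp add: set_lebesgue_integral_def mult.commute)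
qed

end

section \<open>Algebraically decaying profiles\<close>

locale kernel_profile = power_kernel +
  fixes p :: "real \<Rightarrow> real" and \<beta> :: real
  assumes beta: "\<beta> > 0"
    and p_nonneg: "p x \<ge> 0"
    and p_lipschitz: "p x \<le> p y + \<bar>x - y\<bar>"
begin

definition f :: "real \<Rightarrow> real \<Rightarrow> real" where
  "f R x = (1 + (p x / R)\<^sup>2) powr (- \<beta>)"

lemma base_pos: "1 + (y / R)\<^sup>2 > (0::real)"
  by (simp add: add_pos_nonneg)

lemma f_pos: "f R x > 0"
  using base_pos[of "p x" R] by (simp add: f_def)

lemma f_le_1: "f R x \<le> 1"
  using beta powr_mono2'[of "-\<beta>" 1 "1 + (p x / R)\<^sup>2"] by (simp add: f_def)

lemma p_measurable [measurable]: "p \<in> borel_measurable borel"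
proof -
  have "\<bar>p x - p y\<bar> \<le> \<bar>x - y\<bar>" for x y
    using p_lipschitz[of x y] p_lipschitz[of y x] by linarith
  then have "1-lipschitz_on UNIV p"
    by (auto simp: lipschitz_on_def dist_real_def)
  then show ?thesis
    by (intro borel_measurable_continuous_onI lipschitz_on_continuous_on)
qed

lemma f_measurable [measurable]: "f R \<in> borel_measurable borel"
  unfolding f_def[abs_def] by measurable

lemma integrable_conv_f: "integrable lebesgue (\<lambda>y. a (x - y) * f R y)"
  using f_pos f_le_1
  by (intro integrable_conv[where B = 1] measurable_completion) (auto simp: less_imp_le)

text \<open>A form of Peetre's inequality.\<close>

lemma f_near:
  assumes R: "R > 0" and d: "d \<ge> 0" "p x \<le> p y + d"
  shows "f R y \<le> (1 + d / R) powr (2 * \<beta>) * f R x"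
proof -
  define X Y D where "X = p x / R" "Y = p y / R" "D = d / R"
  have nn: "X \<ge> 0" "Y \<ge> 0" "D \<ge> 0" using R d p_nonneg by (auto simp: X_Y_D_def)
  have "X \<le> Y + D" using d R by (simp add: X_Y_D_def add_divide_distrib[symmetric] divide_right_mono)
  then have "1 + X\<^sup>2 \<le> 1 + (Y + D)\<^sup>2" using nn by (simp add: power_mono)
  also have "\<dots> \<le> (1 + D)\<^sup>2 * (1 + Y\<^sup>2)"
  proof -
    have "(1 + D)\<^sup>2 * (1 + Y\<^sup>2) - (1 + (Y + D)\<^sup>2) = D * ((1 - Y)\<^sup>2 + 1 + Y\<^sup>2) + D\<^sup>2 * Y\<^sup>2"
      by (simp add: power2_eq_square algebra_simps)
    moreover have "0 \<le> D * ((1 - Y)\<^sup>2 + 1 + Y\<^sup>2) + D\<^sup>2 * Y\<^sup>2" using nn by simp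
    ultimately show ?thesis by linarith
  qed
  finally have "((1 + D)\<^sup>2 * (1 + Y\<^sup>2)) powr (- \<beta>) \<le> (1 + X\<^sup>2) powr (- \<beta>)"
    using beta by (intro powr_mono2') (auto simp: add_pos_nonneg)
  moreover have "((1 + D)\<^sup>2 * (1 + Y\<^sup>2)) powr (- \<beta>) = ((1 + D)\<^sup>2) powr (- \<beta>) * (1 + Y\<^sup>2) powr (- \<beta>)"
    by (simp add: powr_mult)
  moreover have "((1 + D)\<^sup>2) powr (- \<beta>) = inverse ((1 + D) powr (2 * \<beta>))"
  proof -
    have *: "(1 + D)\<^sup>2 = (1 + D) powr 2" using nn by simp
    show ?thesis unfolding * powr_powr by (simp add: powr_minus[symmetric])
  qed
  moreover have "(1 + D) powr (2 * \<beta>) > 0" using nn by simp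
  ultimately show ?thesis unfolding f_def X_Y_D_def[symmetric]
    by (simp add: field_simps)
qed

lemma near_factor:
  assumes A: "A > 0" and \<delta>: "\<delta> > 0"
  shows "\<exists>R0\<ge>1. \<forall>R\<ge>R0. (1 + A / R) powr (2 * \<beta>) \<le> 1 + \<delta>"
proof -
  \<comment> \<open>The solution of
    \<open>(1 + \<kappa>) powr (2 * \<beta>) = 1 + \<delta>\<close>.\<close>
  define \<kappa> where "\<kappa> = (1 + \<delta>) powr (1 / (2 * \<beta>)) - 1"
  have \<kappa>: "\<kappa> > 0" using \<delta> beta by (simp add: \<kappa>_def)
  show ?thesis
  proof (intro exI[of _ "max 1 (A / \<kappa>)"] conjI allI impI)
    fix R assume R: "max 1 (A / \<kappa>) \<le> R"
    then have "A / R \<le> \<kappa>" using \<kappa> A by (auto simp: field_simps)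
    then have "(1 + A / R) powr (2 * \<beta>) \<le> (1 + \<kappa>) powr (2 * \<beta>)"
      using R A beta by (intro powr_mono2) (auto simp: field_simps)
    also have "\<dots> = 1 + \<delta>" using \<delta> beta by (simp add: \<kappa>_def powr_powr)
    finally show "(1 + A / R) powr (2 * \<beta>) \<le> 1 + \<delta>" .
  qed simp
qed

text \<open>Most of the mass of \<open>a\<close> lies in a window \<open>{-A..A}\<close>, on which
  \<open>f R\<close> varies by a factor close to 1 once \<open>R\<close> is large compared with
  \<open>A\<close>. The points outside contribute nonnegatively.\<close>

lemma conv_f_ge:
  assumes \<delta>: "0 < \<delta>" "\<delta> < 1"
  shows "\<exists>R0\<ge>1. \<forall>R\<ge>R0. \<forall>x. (1 - \<delta>) * f R x \<le> (\<integral>y. a (x - y) * f R y \<partial>lebesgue)"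
proof -
  obtain A where A: "A > 0" and mass: "(\<integral>z. a z * indicator {-A..A} z \<partial>lebesgue) \<ge> 1 - \<delta> / 2"
    using central_mass[of "\<delta> / 2"] \<delta> by auto
  obtain R0 where R0: "R0 \<ge> 1" "\<And>R. R \<ge> R0 \<Longrightarrow> (1 + A / R) powr (2 * \<beta>) \<le> 1 + \<delta> / 2"
    using near_factor[OF A, of "\<delta> / 2"] \<delta> by auto
  show ?thesis
  proof (intro exI[of _ R0] conjI R0(1) allI impI)
    fix R x assume R: "R \<ge> R0"
    let ?i = "indicator {-A..A} :: real \<Rightarrow> real"
    let ?k = "f R x / (1 + \<delta> / 2)"
    have pw: "?k * (a (x - y) * ?i (x - y)) \<le> a (x - y) * f R y" for y
    proof (cases "x - y \<in> {-A..A}")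
      case True
      have "f R x \<le> (1 + A / R) powr (2 * \<beta>) * f R y"
        using R R0 A True p_lipschitz[of y x] by (intro f_near) auto
      also have "\<dots> \<le> (1 + \<delta> / 2) * f R y"
        using R0(2)[OF R] f_pos[of R y] by (intro mult_right_mono) auto
      finally have "?k \<le> f R y" using \<delta> by (simp add: field_simps)
      from mult_left_mono[OF this a_nonneg[of "x - y"]] show ?thesis
        using True by (simp add: mult.commute)
    next
      case False
      then show ?thesis using a_nonneg[of "x - y"] f_pos[of R y] by (simp add: less_imp_le)
    qed
    \<comment> \<open>The missing mass \<open>\<delta> / 2\<close> and the oscillation factor
      \<open>1 + \<delta> / 2\<close> together cost no more than the factor
      \<open>1 - \<delta>\<close>.\<close>
    have "(1 - \<delta>) * (1 + \<delta> / 2) \<le> 1 - \<delta> / 2" using \<delta> by (simp add: algebra_simps)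
    then have "1 - \<delta> \<le> (1 - \<delta> / 2) / (1 + \<delta> / 2)" using \<delta> by (simp add: field_simps)
    then have "(1 - \<delta>) * f R x \<le> (1 - \<delta> / 2) / (1 + \<delta> / 2) * f R x"
      using f_pos[of R x] by (intro mult_right_mono) auto
    also have "\<dots> = ?k * (1 - \<delta> / 2)" by simp
    also have "\<dots> \<le> ?k * (\<integral>z. a z * ?i z \<partial>lebesgue)"
      using mass f_pos[of R x] \<delta> by (intro mult_left_mono) auto
    also have "(\<integral>z. a z * ?i z \<partial>lebesgue) = (\<integral>y. a (x - y) * ?i (x - y) \<partial>lebesgue)"
      by (rule integral_lebesgue_reflect[of "\<lambda>z. a z * ?i z", symmetric]) measurable
    also have "?k * \<dots> = (\<integral>y. ?k * (a (x - y) * ?i (x - y)) \<partial>lebesgue)"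
      by simp
    also have "\<dots> \<le> (\<integral>y. a (x - y) * f R y \<partial>lebesgue)"
    proof (rule Bochner_Integration.integral_mono)
      have "integrable lebesgue (\<lambda>y. a (x - y) * ?i (x - y))"
        by (rule integrable_lebesgue_reflect[of "\<lambda>z. a z * ?i z"])
          (auto intro: integrable_a_indicator)
      then show "integrable lebesgue (\<lambda>y. ?k * (a (x - y) * ?i (x - y)))"
        by (rule integrable_mult_right)
    qed (use pw integrable_conv_f in auto)
    finally show "(1 - \<delta>) * f R x \<le> (\<integral>y. a (x - y) * f R y \<partial>lebesgue)" .
  qed
qed

text \<open>
  At distance more than \<open>A\<close> from \<open>x\<close>, either \<open>f R y\<close> is comparable to \<open>f R x\<close>, and the
  small mass of the tail of \<open>a\<close> suffices, or \<open>y\<close> is much closer to the bulk than \<open>x\<close>; the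
  remainder \<open>r\<close> covers the latter points.
\<close>

lemma conv_f_le:
  assumes \<delta>: "0 < \<delta>" and K: "K > 0"
    and far: "\<And>\<delta>'. \<delta>' > 0 \<Longrightarrow> \<exists>A0. \<forall>A\<ge>A0. \<exists>R1. \<forall>R\<ge>R1. \<forall>x. \<exists>r. integrable lebesgue r \<and>
      (\<forall>y. r y \<ge> 0) \<and> (\<forall>y. A < \<bar>x - y\<bar> \<longrightarrow> a (x - y) * f R y \<le> K * a (x - y) * f R x + r y) \<and>
      (\<integral>y. r y \<partial>lebesgue) \<le> \<delta>' * f R x"
  shows "\<exists>R\<ge>1. \<forall>x. (\<integral>y. a (x - y) * f R y \<partial>lebesgue) \<le> (1 + \<delta>) * f R x"
proof -
  \<comment> \<open>One third each for the oscillation of \<open>f R\<close> near \<open>x\<close>,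
    the tail mass of \<open>a\<close> weighted by \<open>K\<close>, and the remainder
    \<open>r\<close>.\<close>
  define \<eta> where "\<eta> = \<delta> / 3"
  have \<eta>: "\<eta> > 0" using \<delta> by (simp add: \<eta>_def)
  obtain A0 where A0: "\<And>A. A \<ge> A0 \<Longrightarrow> \<exists>R1. \<forall>R\<ge>R1. \<forall>x. \<exists>r. integrable lebesgue r \<and>
      (\<forall>y. r y \<ge> 0) \<and> (\<forall>y. A < \<bar>x - y\<bar> \<longrightarrow> a (x - y) * f R y \<le> K * a (x - y) * f R x + r y) \<and>
      (\<integral>y. r y \<partial>lebesgue) \<le> \<eta> * f R x"
    using far[OF \<eta>] by blast
  obtain A1 where A1: "A1 > 0"
    "\<And>A. A \<ge> A1 \<Longrightarrow> (\<integral>z. a z * indicator {-A..A} z \<partial>lebesgue) \<ge> 1 - \<eta> / K"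
    using central_mass[of "\<eta> / K"] \<eta> K by auto
  define A where "A = max A0 A1"
  have A: "A \<ge> A0" "A > 0" and mass: "(\<integral>z. a z * indicator {-A..A} z \<partial>lebesgue) \<ge> 1 - \<eta> / K"
    using A1(1) A1(2)[of A] by (auto simp: A_def)
  obtain R1 where R1: "\<And>R x. R \<ge> R1 \<Longrightarrow> \<exists>r. integrable lebesgue r \<and> (\<forall>y. r y \<ge> 0) \<and>
      (\<forall>y. A < \<bar>x - y\<bar> \<longrightarrow> a (x - y) * f R y \<le> K * a (x - y) * f R x + r y) \<and>
      (\<integral>y. r y \<partial>lebesgue) \<le> \<eta> * f R x"
    using A0[OF A(1)] by blast
  obtain R0 where R0: "R0 \<ge> 1" "\<And>R. R \<ge> R0 \<Longrightarrow> (1 + A / R) powr (2 * \<beta>) \<le> 1 + \<eta>"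
    using near_factor[OF A(2) \<eta>] by auto
  define R where "R = max R0 R1"
  have R: "R \<ge> 1" "R \<ge> R0" "R \<ge> R1" using R0(1) by (auto simp: R_def)
  show ?thesis
  proof (intro exI[of _ R] conjI R(1) allI)
    fix x
    obtain r where r: "integrable lebesgue r" "\<And>y. r y \<ge> 0"
      "\<And>y. A < \<bar>x - y\<bar> \<Longrightarrow> a (x - y) * f R y \<le> K * a (x - y) * f R x + r y"
      "(\<integral>y. r y \<partial>lebesgue) \<le> \<eta> * f R x"
      using R1[OF R(3), of x] by blast
    let ?i = "indicator {-A..A} :: real \<Rightarrow> real"
    have F: "f R x > 0" by (rule f_pos)
    \<comment> \<open>One formula covers both regions: inside the window the terms with
      \<open>K\<close> cancel, outside it the indicator vanishes and more than the bound of
      \<open>far\<close> remains. Its integral involves only the total mass, the window mass and the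
      integral of \<open>r\<close>.\<close>
    have pw: "a (x - y) * f R y \<le>
        (1 + \<eta> + K) * f R x * a (x - y) - K * f R x * (a (x - y) * ?i (x - y)) + r y" for y
    proof (cases "x - y \<in> {-A..A}")
      case True
      have "f R y \<le> (1 + A / R) powr (2 * \<beta>) * f R x"
        using R A True p_lipschitz[of x y] by (intro f_near) auto
      also have "\<dots> \<le> (1 + \<eta>) * f R x"
        using R0(2)[OF R(2)] F by (intro mult_right_mono) auto
      finally have "a (x - y) * f R y \<le> a (x - y) * ((1 + \<eta>) * f R x)"
        by (intro mult_left_mono a_nonneg)
      then show ?thesis using True r(2)[of y] by (simp add: algebra_simps)
    next
      case False
      then have "A < \<bar>x - y\<bar>" by auto
      from r(3)[OF this] have "a (x - y) * f R y \<le> K * a (x - y) * f R x + r y" .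
      moreover have "0 \<le> (1 + \<eta>) * f R x * a (x - y)" using \<eta> F a_nonneg by simp
      ultimately show ?thesis using False by (simp add: algebra_simps)
    qed
    have i1: "integrable lebesgue (\<lambda>y. a (x - y))"
      by (intro integrable_lebesgue_reflect integrable_a) simp
    have i2: "integrable lebesgue (\<lambda>y. a (x - y) * ?i (x - y))"
      by (rule integrable_lebesgue_reflect[of "\<lambda>z. a z * ?i z"])
        (auto intro: integrable_a_indicator)
    have e1: "(\<integral>y. a (x - y) \<partial>lebesgue) = 1"
      using integral_lebesgue_reflect[OF a_measurable, of x] integral_a by simp
    have e2: "(\<integral>y. a (x - y) * ?i (x - y) \<partial>lebesgue) = (\<integral>z. a z * ?i z \<partial>lebesgue)"
      by (rule integral_lebesgue_reflect[of "\<lambda>z. a z * ?i z"]) measurable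
    have "(\<integral>y. a (x - y) * f R y \<partial>lebesgue) \<le>
        (\<integral>y. (1 + \<eta> + K) * f R x * a (x - y) - K * f R x * (a (x - y) * ?i (x - y)) + r y \<partial>lebesgue)"
      using pw i1 i2 r(1) integrable_conv_f by (intro Bochner_Integration.integral_mono) auto
    also have "\<dots> = (1 + \<eta> + K) * f R x - K * f R x * (\<integral>z. a z * ?i z \<partial>lebesgue)
        + (\<integral>y. r y \<partial>lebesgue)"
      using i1 i2 r(1) e1 e2 by simp
    also have "\<dots> \<le> (1 + \<eta> + K) * f R x - K * f R x * (1 - \<eta> / K) + \<eta> * f R x"
    proof -
      have "K * f R x * (1 - \<eta> / K) \<le> K * f R x * (\<integral>z. a z * ?i z \<partial>lebesgue)"
        using mass K F by (intro mult_left_mono) auto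
      then show ?thesis using r(4) by linarith
    qed
    also have "\<dots> = (1 + \<delta>) * f R x"
      using K by (simp add: \<eta>_def field_simps)
    finally show "(\<integral>y. a (x - y) * f R y \<partial>lebesgue) \<le> (1 + \<delta>) * f R x" .
  qed
qed

lemma f_le_powr:
  assumes "R > 0" "p x > 0"
  shows "f R x \<le> R powr (2 * \<beta>) * p x powr (- 2 * \<beta>)"
proof -
  have "f R x \<le> ((p x / R)\<^sup>2) powr (- \<beta>)"
    unfolding f_def using assms beta by (intro powr_mono2') auto
  also have "(p x / R)\<^sup>2 = (p x / R) powr 2" using assms by simp
  also have "\<dots> powr (- \<beta>) = (p x / R) powr (- (2 * \<beta>))"
    by (simp only: powr_powr) simp
  also have "\<dots> = R powr (2 * \<beta>) * p x powr (- 2 * \<beta>)"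
    using assms by (simp add: powr_divide powr_minus field_simps)
  finally show ?thesis .
qed

text \<open>Holds because dividing \<open>p x / R\<close> by \<open>q \<ge> 1\<close> shrinks
  \<open>1 + (p x / R)\<^sup>2\<close> by at most \<open>q\<^sup>2\<close>. With
  \<open>q = exp (\<gamma> * h)\<close> it bounds the growth of the moving profile without
  differentiating \<open>f\<close>.\<close>

lemma f_scale:
  assumes "R > 0" "q \<ge> 1"
  shows "f (R * q) x \<le> q powr (2 * \<beta>) * f R x"
proof -
  have "1 / q * (1 / q) * (1 + (p x / R)\<^sup>2) \<le> 1 + (p x / (R * q))\<^sup>2"
    using assms mult_mono[of 1 q 1 q] by (simp add: field_simps power2_eq_square)
  then have "f (R * q) x \<le> (1 / q * (1 / q) * (1 + (p x / R)\<^sup>2)) powr (- \<beta>)"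
    unfolding f_def using assms beta base_pos[of "p x" R]
    by (intro powr_mono2') auto
  also have "\<dots> = (1 / q * (1 / q)) powr (- \<beta>) * f R x"
    unfolding f_def using assms base_pos[of "p x" R] by (intro powr_mult) 
  also have "(1 / q * (1 / q)) powr (- \<beta>) = q powr (2 * \<beta>)"
  proof -
    have *: "1 / q * (1 / q) = q powr (-2)"
      using assms by (simp add: powr_minus power2_eq_square field_simps)
    show ?thesis unfolding * powr_powr by simp
  qed
  finally show ?thesis .
qed

lemma f_comparable:
  assumes "1 + (p x / R)\<^sup>2 \<le> K * (1 + (p y / R)\<^sup>2)" "K > 0"
  shows "f R y \<le> K powr \<beta> * f R x"
proof -
  have "f R y = K powr \<beta> * (K powr (- \<beta>) * f R y)"
    using assms(2) by (simp add: powr_minus)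
  also have "K powr (- \<beta>) * f R y = (K * (1 + (p y / R)\<^sup>2)) powr (- \<beta>)"
    by (simp add: f_def powr_mult)
  also have "K powr \<beta> * \<dots> \<le> K powr \<beta> * f R x"
    unfolding f_def using assms(1) beta base_pos by (intro mult_left_mono powr_mono2') auto
  finally show ?thesis .
qed

lemma f_mono: "0 < R \<Longrightarrow> R \<le> S \<Longrightarrow> f R x \<le> f S x"
  unfolding f_def using beta p_nonneg[of x] base_pos[of "p x" S]
  by (intro powr_mono2') (auto intro!: power_mono divide_left_mono)

lemma f_ge:
  assumes "p x \<le> R" "R > 0" shows "2 powr (- \<beta>) \<le> f R x"
proof -
  have "(p x / R)\<^sup>2 \<le> 1" using assms p_nonneg[of x] by (simp add: power_le_one)
  then show ?thesis unfolding f_def using beta base_pos[of "p x" R]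
    by (intro powr_mono2') auto
qed

end

section \<open>Super- and subsolutions\<close>

locale kernel_solution = power_kernel +
  fixes u0 :: "real \<Rightarrow> real" and u u' :: "real \<Rightarrow> real \<Rightarrow> real"
  assumes curve: "AE_differentiable_curve 0 u u'"
    and equation: "t > 0 \<Longrightarrow> AE x in lebesgue. u' t x = min (\<integral>y. a (x - y) * u t y \<partial>lebesgue) 1"
    and u_Linf: "t \<ge> 0 \<Longrightarrow> u t \<in> Linf"
    and initial: "AE x in lebesgue. u 0 x = u0 x"
    and u0_nonneg: "AE x in lebesgue. 0 \<le> u0 x"
begin

lemma integrable_conv_u: "t \<ge> 0 \<Longrightarrow> integrable lebesgue (\<lambda>y. a (x - y) * u t y)"
  using integrable_conv[OF Linf_measurable AE_abs_le_Linf_norm, of "u t" x] u_Linf by simp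

text \<open>Comparison with the zero curve: a lower bound \<open>- M\<close> for \<open>u\<close>
  passes to the convolution, and the truncation at 1 does not lower it.\<close>

lemma u_nonneg:
  assumes "t \<ge> 0"
  shows "AE x in lebesgue. 0 \<le> u t x"
proof (rule AE_comparison[OF curve, where V = "\<lambda>_ _. 0" and k = "\<lambda>_ _. 0" and \<rho> = 1])
  show "AE x in lebesgue. 0 \<le> u 0 x"
    using initial u0_nonneg by eventually_elim simp
  fix t M :: real
  assume t: "0 < t" and M: "0 \<le> M" and ae: "AE x in lebesgue. 0 \<le> u t x + M"
  have "0 \<le> (\<integral>y. a (x - y) * u t y \<partial>lebesgue) + M" for x
    using conv_mono[of x "\<lambda>_. 0" "u t" M] ae t integrable_conv_u by simp
  then show "AE x in lebesgue. 0 \<le> u' t x + M"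
    using equation[OF t] by (auto elim!: eventually_mono simp: min_def M)
qed (use assms in auto)

text \<open>Integrates a lower bound on the time derivative that is constant in time. It yields
  monotonicity in time, the first algebraic tail at time 1, and the final rise of \<open>u\<close>
  above \<open>n\<close>.\<close>

lemma linear_growth:
  assumes t0: "t0 \<ge> 0" and w: "AE x in lebesgue. w x \<le> u t0 x"
    and k: "\<And>x. k x \<le> 1"
    and u': "\<And>t. t > t0 \<Longrightarrow> AE x in lebesgue. k x \<le> u' t x"
    and t: "t \<ge> t0"
  shows "AE x in lebesgue. w x + (t - t0) * k x \<le> u t x"
proof (rule AE_comparison[OF AE_differentiable_curve_shift[OF curve t0],
      where V = "\<lambda>t x. w x + (t - t0) * k x" and k = "\<lambda>_. k" and \<rho> = 1])
  show "AE x in lebesgue. w x + (t0 - t0) * k x \<le> u t0 x" using w by simp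
  show "AE x in lebesgue. k x \<le> u' t x + M" if "t0 < t" "0 \<le> M" for t M
    using u'[OF that(1)] by eventually_elim (use that in linarith)
qed (use k t in \<open>auto simp: algebra_simps\<close>)

lemma derivative_ge:
  assumes "t > 0" "\<And>x. k x \<le> 1" "\<And>x. k x \<le> (\<integral>y. a (x - y) * u t y \<partial>lebesgue)"
  shows "AE x in lebesgue. k x \<le> u' t x"
  using equation[OF assms(1)] by eventually_elim (simp add: assms)

lemma u_mono:
  assumes "0 \<le> s" "s \<le> t"
  shows "AE x in lebesgue. u s x \<le> u t x"
proof -
  have "AE x in lebesgue. u s x + (t - s) * 0 \<le> u t x"
  proof (rule linear_growth[OF assms(1), where k = "\<lambda>_. 0"])
    fix r assume r: "r > s"
    then have "(\<integral>y. a (x - y) * u r y \<partial>lebesgue) \<ge> 0" for x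
      using assms u_nonneg[of r]
      by (intro integral_nonneg_AE) (auto elim!: eventually_mono simp: a_nonneg)
    then show "AE x in lebesgue. 0 \<le> u' r x"
      using r assms by (intro derivative_ge) auto
  qed (use assms in auto)
  then show ?thesis by simp
qed

lemma conv_u_ge:
  assumes "0 \<le> s" "s \<le> t" "AE y in lebesgue. g y \<le> u s y"
    "integrable lebesgue (\<lambda>y. a (x - y) * g y)"
  shows "(\<integral>y. a (x - y) * g y \<partial>lebesgue) \<le> (\<integral>y. a (x - y) * u t y \<partial>lebesgue)"
proof -
  have "AE y in lebesgue. g y \<le> u t y + 0"
    using assms(3) u_mono[OF assms(1,2)] by eventually_elim simp
  from conv_mono[OF assms(4) _ this] show ?thesis
    using assms integrable_conv_u by simp
qed

end

section \<open>Upper and lower bounds for the position of the front\<close>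

locale profile_solution = kernel_profile + kernel_solution
begin

text \<open>Dropping the minimum leaves the linear equation, for which an exponential times an
  approximate eigenfunction is a supersolution. The comparison is applied to the negatives of both
  curves.\<close>

lemma supersolution:
  assumes R: "\<And>x. (\<integral>y. a (x - y) * f R y \<partial>lebesgue) \<le> (1 + \<delta>) * f R x"
    and \<delta>: "\<delta> > 0" and C: "C > 0"
    and u0: "AE x in lebesgue. u0 x \<le> C * f R x" and t: "t \<ge> 0"
  shows "AE x in lebesgue. u t x \<le> C * exp ((1 + \<delta>) * t) * f R x"
proof -
  define V where "V t x = C * exp ((1 + \<delta>) * t) * f R x" for t x
  have Vnn: "V t x \<ge> 0" for t x
    using C f_pos[of R x] by (simp add: V_def less_imp_le)
  have "AE x in lebesgue. - V t x \<le> - u t x"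
  proof (rule AE_comparison[OF AE_differentiable_curve_minus[OF curve],
        where V = "\<lambda>t x. - V t x" and k = "\<lambda>t x. - ((1 + \<delta>) * V t x)" and \<rho> = 1])
    show "AE x in lebesgue. - V 0 x \<le> - u 0 x"
      using u0 initial by eventually_elim (simp add: V_def)
    show "- V (t + h) x \<le> - V t x + h * - ((1 + \<delta>) * V t x)" for t h x
    proof -
      \<comment> \<open>Convexity of \<open>exp\<close> gives the increment inequality for every
        \<open>h\<close>.\<close>
      have "V t x * (1 + (1 + \<delta>) * h) \<le> V t x * exp ((1 + \<delta>) * h)"
        by (intro mult_left_mono exp_ge_add_one_self Vnn)
      also have "\<dots> = V (t + h) x"
        by (simp add: V_def exp_add distrib_left)
      finally show ?thesis by (simp add: algebra_simps)
    qed
    show "- ((1 + \<delta>) * V t x) \<le> 1" for t x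
      using Vnn[of t x] \<delta> by (smt (verit) mult_nonneg_nonneg)
    fix t M :: real
    assume t: "0 < t" and "0 \<le> M" and ae: "AE x in lebesgue. - V t x \<le> - u t x + M"
    have ae': "AE x in lebesgue. u t x \<le> V t x + M" using ae by eventually_elim simp
    have le: "(\<integral>y. a (x - y) * u t y \<partial>lebesgue) \<le> (1 + \<delta>) * V t x + M" for x
    proof -
      let ?C = "C * exp ((1 + \<delta>) * t)"
      have eq: "a (x - y) * V t y = ?C * (a (x - y) * f R y)" for y
        by (simp add: V_def)
      have "integrable lebesgue (\<lambda>y. a (x - y) * V t y)"
        unfolding eq by (intro integrable_mult_right integrable_conv_f)
      then have "(\<integral>y. a (x - y) * u t y \<partial>lebesgue) \<le> (\<integral>y. a (x - y) * V t y \<partial>lebesgue) + M"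
        using t ae' by (intro conv_mono integrable_conv_u) auto
      also have "(\<integral>y. a (x - y) * V t y \<partial>lebesgue) = ?C * (\<integral>y. a (x - y) * f R y \<partial>lebesgue)"
        unfolding eq by simp
      also have "\<dots> \<le> ?C * ((1 + \<delta>) * f R x)"
        using R C by (intro mult_left_mono) auto
      finally show ?thesis by (simp add: V_def mult_ac)
    qed
    show "AE x in lebesgue. - ((1 + \<delta>) * V t x) \<le> - u' t x + M"
      using equation[OF t]
    proof eventually_elim
      case (elim x)
      then show ?case using le[of x] by linarith
    qed
  qed (use t in auto)
  then show ?thesis by (simp add: V_def)
qed

text \<open>The profile decays like \<open>p x powr (- 2 * \<beta>)\<close>, so beyond the claimed
  position it is at most a constant times \<open>exp (- ((1 + \<epsilon>) * t))\<close>. The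
  supersolution grows only at rate \<open>1 + \<epsilon> / 2\<close>, and the surplus
  \<open>\<epsilon> / 2\<close> eventually absorbs all constants.\<close>

lemma front_upper_bound:
  assumes conv: "\<And>\<delta>. \<delta> > 0 \<Longrightarrow>
      \<exists>R\<ge>1. \<forall>x. (\<integral>y. a (x - y) * f R y \<partial>lebesgue) \<le> (1 + \<delta>) * f R x"
    and u0: "AE x in lebesgue. u0 x \<le> C * f 1 x"
    and \<epsilon>: "\<epsilon> > 0" and n: "n > 0"
  shows "\<exists>\<tau>\<ge>0. \<forall>t\<ge>\<tau>. AE x in lebesgue.
    1 / n \<le> u t x \<longrightarrow> p x \<le> exp ((1 + \<epsilon>) / (2 * \<beta>) * t)"
proof -
  obtain R where R: "R \<ge> 1"
    "\<And>x. (\<integral>y. a (x - y) * f R y \<partial>lebesgue) \<le> (1 + \<epsilon> / 2) * f R x"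
    using conv[of "\<epsilon> / 2"] \<epsilon> by auto
  define C' where "C' = max C 1"
  have C': "C' > 0" "C \<le> C'" by (auto simp: C'_def)
  have u0': "AE x in lebesgue. u0 x \<le> C' * f R x"
    using u0
  proof eventually_elim
    case (elim x)
    have "C * f 1 x \<le> C' * f R x"
      using C' f_mono[of 1 R x] R(1) f_pos[of 1 x] by (intro mult_mono) auto
    then show ?case using elim by linarith
  qed
  \<comment> \<open>Collects the constants that \<open>exp (\<epsilon> / 2 * t)\<close> has to beat;
    the maximum with 1 makes the threshold \<open>2 / \<epsilon> * ln D\<close> nonnegative.\<close>
  define D where "D = max 1 (n * C' * R powr (2 * \<beta>))"
  have D: "D \<ge> 1" "n * C' * R powr (2 * \<beta>) \<le> D" by (auto simp: D_def)
  show ?thesis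
  proof (intro exI[of _ "2 / \<epsilon> * ln D"] conjI allI impI)
    show "0 \<le> 2 / \<epsilon> * ln D" using D \<epsilon> by simp
    fix t assume t: "2 / \<epsilon> * ln D \<le> t"
    then have t0: "t \<ge> 0" using \<open>0 \<le> 2 / \<epsilon> * ln D\<close> by linarith
    have "ln D \<le> \<epsilon> / 2 * t" using t \<epsilon> by (simp add: field_simps)
    then have De: "D \<le> exp (\<epsilon> / 2 * t)"
      using D by (metis exp_le_cancel_iff exp_ln less_le_trans zero_less_one)
    have "AE x in lebesgue. u t x \<le> C' * exp ((1 + \<epsilon> / 2) * t) * f R x"
      using R \<epsilon> C' u0' t0 by (intro supersolution) auto
    then show "AE x in lebesgue. 1 / n \<le> u t x \<longrightarrow> p x \<le> exp ((1 + \<epsilon>) / (2 * \<beta>) * t)"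
    proof eventually_elim
      case (elim x)
      show ?case
      proof (rule ccontr)
        assume "\<not> ?thesis"
        then have ux: "1 / n \<le> u t x" and px: "p x > exp ((1 + \<epsilon>) / (2 * \<beta>) * t)" by auto
        have "p x > 0" using px by (meson exp_gt_zero less_trans)
        then have "f R x \<le> R powr (2 * \<beta>) * p x powr (- 2 * \<beta>)"
          using R(1) by (intro f_le_powr) auto
        moreover have "p x powr (- 2 * \<beta>) < exp ((1 + \<epsilon>) / (2 * \<beta>) * t) powr (- 2 * \<beta>)"
          using px beta by (intro powr_less_mono2_neg) auto
        moreover have "exp ((1 + \<epsilon>) / (2 * \<beta>) * t) powr (- 2 * \<beta>) = exp (- ((1 + \<epsilon>) * t))"
          using beta by (simp add: powr_def)
        ultimately have "f R x < R powr (2 * \<beta>) * exp (- ((1 + \<epsilon>) * t))"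
          using R(1) by (smt (verit) mult_strict_left_mono powr_gt_zero)
        then have "C' * exp ((1 + \<epsilon> / 2) * t) * f R x <
            C' * exp ((1 + \<epsilon> / 2) * t) * (R powr (2 * \<beta>) * exp (- ((1 + \<epsilon>) * t)))"
          using C' by (intro mult_strict_left_mono) auto
        also have "\<dots> = C' * R powr (2 * \<beta>) * (exp ((1 + \<epsilon> / 2) * t) * exp (- ((1 + \<epsilon>) * t)))"
          by simp
        also have "exp ((1 + \<epsilon> / 2) * t) * exp (- ((1 + \<epsilon>) * t)) = exp (- (\<epsilon> / 2 * t))"
          by (simp add: exp_add[symmetric] algebra_simps)
        finally have "1 / n < C' * R powr (2 * \<beta>) * exp (- (\<epsilon> / 2 * t))"
          using elim ux by linarith
        then have "exp (\<epsilon> / 2 * t) < n * C' * R powr (2 * \<beta>)"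
          using n by (simp add: exp_minus field_simps)
        then show False using D De by linarith
      qed
    qed
  qed
qed

text \<open>The expanding profile grows at rate at most \<open>1 - 2 * \<delta>\<close>, while the
  convolution supplies \<open>1 - \<delta>\<close>. Since \<open>\<theta> \<le> 1\<close>, the curve
  stays below 1 and is compatible with the truncation.\<close>

lemma subsolution:
  assumes R0: "R0 \<ge> 1"
      "\<And>R x. R \<ge> R0 \<Longrightarrow> (1 - \<delta>) * f R x \<le> (\<integral>y. a (x - y) * f R y \<partial>lebesgue)"
    and \<delta>: "0 < \<delta>" "\<delta> < 1 / 2" and \<theta>: "0 < \<theta>" "\<theta> \<le> 1"
    and \<gamma>: "\<gamma> = (1 - 2 * \<delta>) / (2 * \<beta>)"
    and t0: "t0 \<ge> 0" and init: "AE x in lebesgue. \<theta> * f (R0 * exp (\<gamma> * t0)) x \<le> u t0 x"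
    and t: "t \<ge> t0"
  shows "AE x in lebesgue. \<theta> * f (R0 * exp (\<gamma> * t)) x \<le> u t x"
proof -
  define R where "R t = R0 * exp (\<gamma> * t)" for t
  have \<gamma>0: "\<gamma> > 0" using \<gamma> \<delta> beta by simp
  have R_ge: "R t \<ge> R0" if "t \<ge> t0" for t
  proof -
    have "\<gamma> * t \<ge> 0" using that t0 \<gamma>0 by simp
    then have "R0 * 1 \<le> R0 * exp (\<gamma> * t)" using R0(1) by (intro mult_left_mono) auto
    then show ?thesis by (simp add: R_def)
  qed
  define V where "V t x = \<theta> * f (R t) x" for t x
  have V01: "V t x \<ge> 0" "V t x \<le> 1" for t x
    using \<theta> f_pos[of "R t" x] f_le_1[of "R t" x]
    by (auto simp: V_def mult_le_one less_imp_le)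
  have k01: "(1 - \<delta>) * V t x \<le> 1" for t x
    using V01[of t x] \<delta> by (intro mult_le_one) auto
  have "AE x in lebesgue. V t x \<le> u t x"
  proof (rule AE_comparison[OF AE_differentiable_curve_shift[OF curve t0],
        where V = V and k = "\<lambda>t x. (1 - \<delta>) * V t x" and \<rho> = \<delta>])
    show "AE x in lebesgue. V t0 x \<le> u t0 x" using init by (simp add: V_def R_def)
    show "V (t + h) x \<le> V t x + h * ((1 - \<delta>) * V t x)"
      if "t0 \<le> t" "0 < h" "h < \<delta>" for t h x
    proof -
      define y where "y = (1 - 2 * \<delta>) * h"
      have y: "0 \<le> y" "y \<le> h" using \<delta> that by (auto simp: y_def mult_left_le_one_le)
      have "V (t + h) x = \<theta> * f (R t * exp (\<gamma> * h)) x"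
        by (simp add: V_def R_def exp_add distrib_left mult.assoc)
      also have "\<dots> \<le> \<theta> * (exp (\<gamma> * h) powr (2 * \<beta>) * f (R t) x)"
        using \<theta> R_ge[OF that(1)] R0(1) \<gamma>0 that by (intro mult_left_mono f_scale) auto
      also have "exp (\<gamma> * h) powr (2 * \<beta>) = exp y"
        using beta by (simp add: powr_def \<gamma> y_def)
      also have "\<theta> * (exp y * f (R t) x) = exp y * V t x" by (simp add: V_def)
      also have "\<dots> \<le> (1 + h * (1 - \<delta>)) * V t x"
      proof (rule mult_right_mono[OF _ V01(1)])
        \<comment> \<open>For \<open>h < \<delta>\<close> the quadratic term is at most
          \<open>h * \<delta>\<close>, which is the gap between the rates
          \<open>1 - 2 * \<delta>\<close> and \<open>1 - \<delta>\<close>.\<close>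
        have "exp y \<le> 1 + y + y\<^sup>2" using y that \<delta> by (intro exp_bound) auto
        also have "y\<^sup>2 \<le> h * \<delta>" using y that by (auto simp: power2_eq_square intro!: mult_mono)
        finally show "exp y \<le> 1 + h * (1 - \<delta>)" by (simp add: y_def algebra_simps)
      qed
      finally show ?thesis by (simp add: algebra_simps)
    qed
    fix t M :: real
    assume t: "t0 < t" and M: "0 \<le> M" and ae: "AE x in lebesgue. V t x \<le> u t x + M"
    have le: "(1 - \<delta>) * V t x \<le> (\<integral>y. a (x - y) * u t y \<partial>lebesgue) + M" for x
    proof -
      have eq: "a (x - y) * V t y = \<theta> * (a (x - y) * f (R t) y)" for y
        by (simp add: V_def)
      have "(1 - \<delta>) * V t x = \<theta> * ((1 - \<delta>) * f (R t) x)" by (simp add: V_def)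
      also have "\<dots> \<le> \<theta> * (\<integral>y. a (x - y) * f (R t) y \<partial>lebesgue)"
        using \<theta> t R_ge by (intro mult_left_mono R0(2)) auto
      also have "\<dots> = (\<integral>y. a (x - y) * V t y \<partial>lebesgue)" unfolding eq by simp
      also have "\<dots> \<le> (\<integral>y. a (x - y) * u t y \<partial>lebesgue) + M"
      proof (rule conv_mono[OF _ _ ae])
        show "integrable lebesgue (\<lambda>y. a (x - y) * V t y)"
          unfolding eq by (intro integrable_mult_right integrable_conv_f)
      qed (use t t0 integrable_conv_u in auto)
      finally show ?thesis .
    qed
    have "t > 0" using t t0 by simp
    from equation[OF this] show "AE x in lebesgue. (1 - \<delta>) * V t x \<le> u' t x + M"
    proof eventually_elim
      case (elim x)
      then show ?case using le[of x] k01[of t x] M by linarith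
    qed
  qed (use t \<delta> k01 in auto)
  then show ?thesis by (simp add: V_def R_def)
qed

text \<open>The hypothesis concerns \<open>a * u0\<close> and not \<open>u0\<close>: data with
  bounded support have no algebraic tail, but the equation creates one within a unit of
  time.\<close>

lemma front_lower_bound:
  assumes \<eta>: "\<eta> > 0" "\<And>x. \<eta> * f 1 x \<le> (\<integral>y. a (x - y) * u0 y \<partial>lebesgue)"
    and \<epsilon>: "0 < \<epsilon>" "\<epsilon> < 1" and n: "n > 0"
  shows "\<exists>\<tau>\<ge>0. \<forall>t\<ge>\<tau>. AE x in lebesgue.
    u t x \<le> n \<longrightarrow> exp ((1 - \<epsilon>) / (2 * \<beta>) * t) \<le> p x"
proof -
  \<comment> \<open>Makes the speed proportional to \<open>1 - \<epsilon> / 2\<close>; the surplus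
    over \<open>1 - \<epsilon>\<close> will compensate a fixed delay.\<close>
  define \<delta> where "\<delta> = \<epsilon> / 4"
  have \<delta>: "0 < \<delta>" "\<delta> < 1 / 2" using \<epsilon> by (auto simp: \<delta>_def)
  obtain R0 where R0: "R0 \<ge> 1"
      "\<And>R x. R \<ge> R0 \<Longrightarrow> (1 - \<delta>) * f R x \<le> (\<integral>y. a (x - y) * f R y \<partial>lebesgue)"
    using conv_f_ge[of \<delta>] \<delta> by auto
  define \<gamma> where "\<gamma> = (1 - 2 * \<delta>) / (2 * \<beta>)"
  have \<gamma>: "\<gamma> > 0" using \<delta> beta by (simp add: \<gamma>_def)
  define R where "R t = R0 * exp (\<gamma> * t)" for t
  have R_ge: "R t \<ge> R0" "R t \<ge> exp (\<gamma> * t)" if "t \<ge> 0" for t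
    using mult_left_mono[of 1 "exp (\<gamma> * t)" R0] mult_right_mono[of 1 R0 "exp (\<gamma> * t)"] R0(1) \<gamma> that
    by (auto simp: R_def)
  define \<eta>' where "\<eta>' = min \<eta> 1"
  have \<eta>': "0 < \<eta>'" "\<eta>' \<le> 1" "\<eta>' \<le> \<eta>" using \<eta> by (auto simp: \<eta>'_def)
  have k1: "\<eta>' * f 1 x \<le> 1" for x
    using \<eta>' f_le_1[of 1 x] f_pos[of 1 x] by (intro mult_le_one) (auto simp: less_imp_le)
  have u1: "AE x in lebesgue. \<eta>' * f 1 x \<le> u 1 x"
  proof -
    have "AE x in lebesgue. u0 x + (1 - 0) * (\<eta>' * f 1 x) \<le> u 1 x"
    proof (rule linear_growth)
      show "AE x in lebesgue. u0 x \<le> u 0 x" using initial by eventually_elim simp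
      fix t :: real assume t: "t > 0"
      have *: "AE y in lebesgue. u0 y \<le> u 0 y" using initial by eventually_elim simp
      have "\<eta>' * f 1 x \<le> (\<integral>y. a (x - y) * u t y \<partial>lebesgue)" for x
      proof -
        have "\<eta>' * f 1 x \<le> \<eta> * f 1 x" using \<eta>' f_pos[of 1 x] by simp
        also have "\<dots> \<le> (\<integral>y. a (x - y) * u0 y \<partial>lebesgue)" by (rule \<eta>(2))
        also have "\<dots> \<le> (\<integral>y. a (x - y) * u t y \<partial>lebesgue)"
        \<comment> \<open>Without integrability the integral would be 0 by convention, against its
          positive lower bound.\<close>
        proof (cases "integrable lebesgue (\<lambda>y. a (x - y) * u0 y)")
          case True
          then show ?thesis using t by (intro conv_u_ge[OF _ _ *]) auto
        next
          case False
          then have "(\<integral>y. a (x - y) * u0 y \<partial>lebesgue) = 0" by (rule not_integrable_integral_eq)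
          then show ?thesis
            using \<eta>(2)[of x] \<eta>(1) f_pos[of 1 x] mult_pos_pos[of \<eta> "f 1 x"] by linarith
        qed
        finally show ?thesis .
      qed
      then show "AE x in lebesgue. \<eta>' * f 1 x \<le> u' t x"
        using t k1 by (intro derivative_ge) auto
    qed (use k1 in auto)
    then show ?thesis using u0_nonneg by eventually_elim simp
  qed
  \<comment> \<open>Chosen through \<open>f_scale\<close> so that the profile of scale
    \<open>R 1\<close> lies below \<open>\<eta>' * f 1\<close>, hence below \<open>u\<close> at time
    1.\<close>
  define \<theta> where "\<theta> = \<eta>' / R 1 powr (2 * \<beta>)"
  have R1: "R 1 \<ge> 1" using R_ge(1)[of 1] R0(1) by simp
  then have R1p: "R 1 powr (2 * \<beta>) \<ge> 1" using beta by (intro ge_one_powr_ge_zero) auto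
  have \<theta>: "0 < \<theta>" "\<theta> \<le> 1"
    using \<eta>' R1 R1p by (auto simp: \<theta>_def divide_le_eq)
  have "\<theta> * f (R 1) x \<le> \<eta>' * f 1 x" for x
  proof -
    have "\<theta> * f (1 * R 1) x \<le> \<theta> * (R 1 powr (2 * \<beta>) * f 1 x)"
      using R1 \<theta> by (intro mult_left_mono f_scale) auto
    then show ?thesis using R1 R1p by (simp add: \<theta>_def)
  qed
  then have init: "AE x in lebesgue. \<theta> * f (R0 * exp (\<gamma> * 1)) x \<le> u 1 x"
    using u1 unfolding R_def by (auto elim!: eventually_mono intro: order_trans)
  have sub: "AE x in lebesgue. \<theta> * f (R T) x \<le> u T x" if "T \<ge> 1" for T
    unfolding R_def
    by (rule subsolution[OF R0 \<delta> \<theta> \<gamma>_def _ init that]) simp_all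
  \<comment> \<open>The rate of increase guaranteed behind the front:
    \<open>f (R T) \<ge> 2 powr (- \<beta>)\<close> where \<open>p x \<le> R T\<close>, and the
    convolution loses at most the factor \<open>1 - \<delta>\<close>.\<close>
  define \<kappa> where "\<kappa> = (1 - \<delta>) * (\<theta> * 2 powr (- \<beta>))"
  have \<kappa>: "\<kappa> > 0" using \<delta> \<theta> by (simp add: \<kappa>_def)
  have \<kappa>1: "\<kappa> \<le> 1"
  proof -
    have "2 powr (- \<beta>) \<le> (2::real) powr 0" using beta by (intro powr_mono) auto
    then show ?thesis unfolding \<kappa>_def using \<delta> \<theta> by (intro mult_le_one) auto
  qed
  define s where "s = (n + 1) / \<kappa>"
  have s: "s > 0" "s * \<kappa> = n + 1" using \<kappa> n by (auto simp: s_def)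
  \<comment> \<open>The profile reached at time \<open>T\<close> stays below \<open>u\<close>
    forever, so \<open>u\<close> grows at rate \<open>\<kappa>\<close> behind the front and gains
    \<open>n + 1\<close> in time \<open>s\<close>, whatever \<open>T\<close> is.\<close>
  have big: "AE x in lebesgue. p x \<le> R T \<longrightarrow> n < u (T + s) x" if T: "T \<ge> 1" for T
  proof -
    let ?k = "\<lambda>x. \<kappa> * indicator {x. p x \<le> R T} x"
    have "AE x in lebesgue. 0 + ((T + s) - T) * ?k x \<le> u (T + s) x"
    proof (rule linear_growth)
      show "AE x in lebesgue. 0 \<le> u T x" using T by (intro u_nonneg) simp
      show k: "?k x \<le> 1" for x using \<kappa>1 by (simp add: indicator_def)
      fix t assume t: "t > T"
      have "?k x \<le> (\<integral>y. a (x - y) * u t y \<partial>lebesgue)" for x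
      proof -
        have "?k x \<le> (1 - \<delta>) * (\<theta> * f (R T) x)"
        proof (cases "p x \<le> R T")
          case True
          have "R T > 0" using R_ge(1)[of T] R0(1) T by simp
          then have "\<kappa> \<le> (1 - \<delta>) * (\<theta> * f (R T) x)"
            unfolding \<kappa>_def using \<delta> \<theta> True by (intro mult_left_mono f_ge) auto
          then show ?thesis using True by simp
        next
          case False
          then show ?thesis using \<delta> \<theta> f_pos[of "R T" x] by (simp add: less_imp_le)
        qed
        also have "\<dots> = \<theta> * ((1 - \<delta>) * f (R T) x)" by simp
        also have "\<dots> \<le> \<theta> * (\<integral>y. a (x - y) * f (R T) y \<partial>lebesgue)"
          using \<theta> T R_ge by (intro mult_left_mono R0(2)) auto
        also have "\<dots> = (\<integral>y. a (x - y) * (\<theta> * f (R T) y) \<partial>lebesgue)"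
          by (simp add: mult.left_commute)
        also have "\<dots> \<le> (\<integral>y. a (x - y) * u t y \<partial>lebesgue)"
        proof (rule conv_u_ge[OF _ _ sub[OF T]])
          show "integrable lebesgue (\<lambda>y. a (x - y) * (\<theta> * f (R T) y))"
            using integrable_mult_right[OF integrable_conv_f, of \<theta> x "R T"]
            by (simp add: mult.left_commute)
        qed (use t T in auto)
        finally show ?thesis .
      qed
      then show "AE x in lebesgue. ?k x \<le> u' t x"
        using t T k by (intro derivative_ge) auto
    qed (use T s in auto)
    then show ?thesis
    proof eventually_elim
      case (elim x)
      then show ?case using s(2) by (auto simp: indicator_def)
    qed
  qed
  show ?thesis
  proof (intro exI[of _ "max (s + 1) (2 * s / \<epsilon>)"] conjI allI impI)
    show "0 \<le> max (s + 1) (2 * s / \<epsilon>)" using s by simp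
    fix t assume t: "max (s + 1) (2 * s / \<epsilon>) \<le> t"
    then have ts: "t - s \<ge> 1" "2 * s \<le> \<epsilon> * t" using \<epsilon> by (auto simp: field_simps)
    \<comment> \<open>The front is evaluated at \<open>t - s\<close>. The surplus speed makes up for
      the delay \<open>s\<close> as soon as \<open>2 * s \<le> \<epsilon> * t\<close>.\<close>
    have "(1 - \<epsilon>) * t \<le> (1 - 2 * \<delta>) * (t - s)"
    proof -
      have "(1 - 2 * \<delta>) * (t - s) - (1 - \<epsilon>) * t = (\<epsilon> * t - 2 * s) / 2 + \<epsilon> / 2 * s"
        by (simp add: \<delta>_def field_simps)
      moreover have "(\<epsilon> * t - 2 * s) / 2 + \<epsilon> / 2 * s \<ge> 0" using ts \<epsilon> s by simp
      ultimately show ?thesis by linarith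
    qed
    then have "(1 - \<epsilon>) / (2 * \<beta>) * t \<le> \<gamma> * (t - s)"
      using beta by (simp add: \<gamma>_def divide_right_mono)
    then have E: "exp ((1 - \<epsilon>) / (2 * \<beta>) * t) \<le> R (t - s)"
      using R_ge(2)[of "t - s"] ts by (smt (verit) exp_le_cancel_iff)
    show "AE x in lebesgue. u t x \<le> n \<longrightarrow> exp ((1 - \<epsilon>) / (2 * \<beta>) * t) \<le> p x"
      using big[OF ts(1)] by eventually_elim (use E in auto)
  qed
qed

end

section \<open>The two profiles\<close>

locale abs_profile = kernel_profile \<alpha> c a "\<lambda>x. \<bar>x\<bar>" \<alpha> for \<alpha> c a
begin

lemma f_eq: "f R x = a (x / R) / c"
  using c_pos unfolding f_def a_eq by (simp add: power_divide)

text \<open>Here the profile is the kernel itself at scale \<open>R\<close>, up to the factor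
  \<open>c\<close>, so its mass comes from a substitution.\<close>

lemma integral_f:
  assumes "R > 0"
  shows "integrable lebesgue (f R)" "(\<integral>y. f R y \<partial>lebesgue) = R / c"
proof -
  have eq: "f R = (\<lambda>y. a (0 + 1 / R * y) / c)" by (simp add: f_eq fun_eq_iff)
  have "integrable lborel (\<lambda>y. a (0 + 1 / R * y))"
    using assms integrable_a
    by (intro lborel_integrable_real_affine) (auto simp: integrable_completion)
  then have "integrable lborel (f R)" unfolding eq by simp
  then show "integrable lebesgue (f R)" by (subst integrable_completion) auto
  have "(\<integral>y. a (0 + 1 / R * y) \<partial>lborel) = R * (\<integral>y. a y \<partial>lborel)"
    using assms lborel_integral_real_affine[of "1 / R" a 0] by (simp add: field_simps)
  also have "(\<integral>y. a y \<partial>lborel) = 1"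
    using integral_a by (subst (asm) integral_completion) auto
  finally have "(\<integral>y. f R y \<partial>lborel) = R / c" unfolding eq by simp
  then show "(\<integral>y. f R y \<partial>lebesgue) = R / c" by (subst integral_completion) auto
qed

text \<open>If \<open>\<bar>x - y\<bar>\<close> is large compared with \<open>R\<close> and
  \<open>\<bar>x\<bar>\<close>, then \<open>a (x - y)\<close> is at most a constant \<open>k\<close>
  of order \<open>R powr (- 2 * \<alpha>) * f R x\<close>; the mass \<open>R / c\<close> of
  \<open>f R\<close> leaves the small factor \<open>R powr (1 - 2 * \<alpha>)\<close>. Otherwise
  \<open>f R y\<close> and \<open>f R x\<close> are comparable, with
  \<open>K = 4 powr \<alpha>\<close>.\<close>

lemma conv_f_upper:
  assumes "\<delta> > 0"
  shows "\<exists>R\<ge>1. \<forall>x. (\<integral>y. a (x - y) * f R y \<partial>lebesgue) \<le> (1 + \<delta>) * f R x"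
proof (rule conv_f_le[OF assms, where K = "4 powr \<alpha>"])
  fix \<delta>' :: real assume \<delta>': "\<delta>' > 0"
  define R1 where "R1 = max 1 ((\<delta>' / 4 powr \<alpha>) powr (1 / (1 - 2 * \<alpha>)))"
  have R1: "4 powr \<alpha> * R powr (1 - 2 * \<alpha>) \<le> \<delta>'" if "R \<ge> R1" for R
  proof -
    have "R powr (1 - 2 * \<alpha>) \<le> ((\<delta>' / 4 powr \<alpha>) powr (1 / (1 - 2 * \<alpha>))) powr (1 - 2 * \<alpha>)"
      using that alpha \<delta>' by (intro powr_mono2') (auto simp: R1_def)
    also have "\<dots> = \<delta>' / 4 powr \<alpha>" using alpha \<delta>' by (simp add: powr_powr)
    finally show ?thesis by (simp add: field_simps)
  qed
  have "\<exists>r. integrable lebesgue r \<and> (\<forall>y. r y \<ge> 0) \<and>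
      (\<forall>y. A < \<bar>x - y\<bar> \<longrightarrow> a (x - y) * f R y \<le> 4 powr \<alpha> * a (x - y) * f R x + r y) \<and>
      (\<integral>y. r y \<partial>lebesgue) \<le> \<delta>' * f R x" if R: "R \<ge> R1" for A R x
  proof -
    have R0: "R > 0" using R by (simp add: R1_def)
    define k where "k = 4 powr \<alpha> * c * R powr (- 2 * \<alpha>) * f R x"
    have k: "k \<ge> 0" using c_pos f_pos[of R x] by (simp add: k_def less_imp_le)
    have pw: "a (x - y) * f R y \<le> 4 powr \<alpha> * a (x - y) * f R x + k * f R y" for y
    proof (cases "1 + (\<bar>x\<bar> / R)\<^sup>2 \<le> 4 * ((x - y) / R)\<^sup>2")
      case True
      then have nz: "x \<noteq> y" using base_pos[of "\<bar>x\<bar>" R] by auto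
      have "(4 * ((x - y) / R)\<^sup>2) powr (- \<alpha>) \<le> f R x"
        unfolding f_def using True alpha base_pos by (intro powr_mono2') auto
      also have "(4 * ((x - y) / R)\<^sup>2) = 4 * ((\<bar>x - y\<bar> / R) powr 2)"
        using nz R0 by (simp add: power_divide)
      also have "\<dots> powr (- \<alpha>) = 4 powr (- \<alpha>) * (\<bar>x - y\<bar> powr (- 2 * \<alpha>) / R powr (- 2 * \<alpha>))"
        using R0 by (simp only: powr_mult powr_powr powr_divide) simp
      also have "4 powr (- \<alpha>) = 1 / (4::real) powr \<alpha>" by (simp add: powr_minus divide_inverse)
      finally have scaled:
        "1 / 4 powr \<alpha> * (\<bar>x - y\<bar> powr (- 2 * \<alpha>) / R powr (- 2 * \<alpha>)) \<le> f R x" .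
      have "d \<le> r * s * F" if "1 / r * (d / s) \<le> F" "r > 0" "s > 0" for d r s F :: real
        using that by (simp add: field_simps)
      from this[OF scaled]
      have "\<bar>x - y\<bar> powr (- 2 * \<alpha>) \<le> 4 powr \<alpha> * R powr (- 2 * \<alpha>) * f R x"
        using R0 by simp
      then have "c * \<bar>x - y\<bar> powr (- 2 * \<alpha>) \<le> k"
        using mult_left_mono[of _ _ c] c_pos by (simp add: k_def mult_ac)
      then have "a (x - y) \<le> k" using a_le[of "x - y"] nz by simp
      then have "a (x - y) * f R y \<le> k * f R y" using f_pos by (intro mult_right_mono) (auto simp: less_imp_le)
      moreover have "0 \<le> 4 powr \<alpha> * a (x - y) * f R x"
        using a_nonneg f_pos[of R x] by (simp add: less_imp_le)
      ultimately show ?thesis by linarith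
    next
      case False
      define X Y where "X = x / R" and "Y = y / R"
      have *: "4 * (X - Y)\<^sup>2 < 1 + X\<^sup>2"
        using False by (simp add: X_def Y_def power_divide diff_divide_distrib[symmetric])
      \<comment> \<open>By \<open>*\<close>, the last term is less than half of the left side and is
        absorbed there, which produces the factor 4.\<close>
      have "1 + X\<^sup>2 \<le> 2 * (1 + Y\<^sup>2) + 2 * (X - Y)\<^sup>2"
        using zero_le_power2[of "X - 2 * Y"] by (simp add: power2_eq_square algebra_simps)
      with * have "1 + X\<^sup>2 \<le> 4 * (1 + Y\<^sup>2)" by linarith
      then have "f R y \<le> 4 powr \<alpha> * f R x"
        by (intro f_comparable) (auto simp: X_def Y_def power_divide)
      then have "a (x - y) * f R y \<le> a (x - y) * (4 powr \<alpha> * f R x)"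
        by (intro mult_left_mono a_nonneg)
      moreover have "0 \<le> k * f R y" using k f_pos[of R y] by simp
      ultimately show ?thesis by (simp add: mult_ac)
    qed
    have "(\<integral>y. k * f R y \<partial>lebesgue) = k * (R / c)"
      using integral_f[OF R0] by simp
    also have "\<dots> = 4 powr \<alpha> * R powr (1 - 2 * \<alpha>) * f R x"
      using c_pos R0 powr_add[of R 1 "- 2 * \<alpha>"] by (simp add: k_def)
    also have "\<dots> \<le> \<delta>' * f R x"
      using R1[OF R] f_pos[of R x] by (intro mult_right_mono) auto
    finally have "(\<integral>y. k * f R y \<partial>lebesgue) \<le> \<delta>' * f R x" .
    moreover have "integrable lebesgue (\<lambda>y. k * f R y)"
      using integral_f[OF R0] by simp
    moreover have "k * f R y \<ge> 0" for y using k f_pos[of R y] by simp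
    ultimately show ?thesis using pw by (intro exI[of _ "\<lambda>y. k * f R y"]) auto
  qed
  then show "\<exists>A0. \<forall>A\<ge>A0. \<exists>R1. \<forall>R\<ge>R1. \<forall>x. \<exists>r. integrable lebesgue r \<and> (\<forall>y. r y \<ge> 0) \<and>
      (\<forall>y. A < \<bar>x - y\<bar> \<longrightarrow> a (x - y) * f R y \<le> 4 powr \<alpha> * a (x - y) * f R x + r y) \<and>
      (\<integral>y. r y \<partial>lebesgue) \<le> \<delta>' * f R x"
    by blast
qed simp

text \<open>Every point of the bump lies within \<open>\<bar>x\<bar> + k\<close> of
  \<open>x\<close>, and by Peetre's inequality the shift by \<open>k\<close> costs only the constant
  factor \<open>q\<close>.\<close>

lemma conv_bump_ge:
  assumes g: "g \<in> Linf" "AE y in lebesgue. 0 \<le> g y"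
    and \<mu>: "\<mu> > 0" "AE y in lebesgue. y \<in> {x0 - \<mu>..x0 + \<mu>} \<longrightarrow> \<mu> \<le> g y"
  shows "\<exists>\<eta>>0. \<forall>x. \<eta> * f 1 x \<le> (\<integral>y. a (x - y) * g y \<partial>lebesgue)"
proof -
  define k where "k = \<bar>x0\<bar> + \<mu>"
  define q where "q = (1 + k) powr (2 * \<alpha>)"
  have q: "q > 0" using \<mu>(1) by (simp add: q_def k_def add_nonneg_eq_0_iff)
  show ?thesis
  proof (intro exI[of _ "\<mu> * (2 * \<mu>) * c / q"] conjI allI)
    show "0 < \<mu> * (2 * \<mu>) * c / q" using \<mu> c_pos q by simp
    fix x
    have "f 1 x \<le> (1 + k / 1) powr (2 * \<alpha>) * f 1 (\<bar>x\<bar> + k)"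
      using \<mu>(1) by (intro f_near) (auto simp: k_def)
    then have "c * f 1 x \<le> q * a (\<bar>x\<bar> + k)"
      using c_pos by (simp add: q_def f_eq field_simps)
    then have "c * f 1 x / q \<le> a (\<bar>x\<bar> + k)" using q by (simp add: field_simps)
    then have "\<mu> * (2 * \<mu>) * (c * f 1 x / q) \<le> \<mu> * (2 * \<mu>) * a (\<bar>x\<bar> + k)"
      using \<mu>(1) by (intro mult_left_mono) auto
    also have "\<dots> = \<mu> * ((x0 + \<mu>) - (x0 - \<mu>)) * a (\<bar>x\<bar> + k)" by simp
    also have "\<dots> \<le> (\<integral>y. a (x - y) * g y \<partial>lebesgue)"
      using \<mu> by (intro conv_ge_interval[OF g]) (auto simp: k_def)
    finally show "\<mu> * (2 * \<mu>) * c / q * f 1 x \<le> (\<integral>y. a (x - y) * g y \<partial>lebesgue)" by simp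
  qed
qed

end

section \<open>Front-like data: the profile built on \<open>max x 0\<close>\<close>

locale positive_part_profile =
  kernel_profile \<alpha> c a "\<lambda>x. max x 0" "\<alpha> - 1 / 2" for \<alpha> c a
begin

lemma powr_exponent: "m > 0 \<Longrightarrow> m powr (1 - 2 * \<alpha>) = (m\<^sup>2) powr (- (\<alpha> - 1 / 2))"
proof -
  assume "m > 0"
  then have *: "m\<^sup>2 = m powr 2" by simp
  show ?thesis unfolding * powr_powr by (simp add: algebra_simps)
qed

text \<open>The tail of \<open>a\<close> and the profile have the same decay rate, since
  \<open>1 - 2 * \<alpha>\<close> is minus twice \<open>\<alpha> - 1 / 2\<close>. A large
  \<open>L\<close> makes the constant small.\<close>

lemma tail_le_f:
  assumes m: "m > 0" and L: "L > 0" "L * (1 + (max x 0 / R)\<^sup>2) \<le> m\<^sup>2"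
  shows "(\<integral>z. a z * indicator {m..} z \<partial>lebesgue)
    \<le> c / (2 * \<alpha> - 1) * L powr (- (\<alpha> - 1 / 2)) * f R x"
proof -
  have "(m\<^sup>2) powr (- (\<alpha> - 1 / 2)) \<le> (L * (1 + (max x 0 / R)\<^sup>2)) powr (- (\<alpha> - 1 / 2))"
    using L beta base_pos by (intro powr_mono2') auto
  also have "\<dots> = L powr (- (\<alpha> - 1 / 2)) * f R x" by (simp add: f_def powr_mult)
  finally have "c / (2 * \<alpha> - 1) * m powr (1 - 2 * \<alpha>)
      \<le> c / (2 * \<alpha> - 1) * (L powr (- (\<alpha> - 1 / 2)) * f R x)"
    unfolding powr_exponent[OF m] using c_pos alpha by (intro mult_left_mono) auto
  then show ?thesis using tail_le[OF m] by (simp only: mult.assoc)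
qed

text \<open>If \<open>max x 0 \<le> 2 * max y 0\<close>, the profiles are comparable. Otherwise
  \<open>y\<close> lies to the left of \<open>x\<close> by at least
  \<open>m = max A (x / 2)\<close>; there \<open>f R y \<le> 1\<close> is used, and the remainder is
  the tail of \<open>a\<close> beyond \<open>m\<close>, a small multiple of
  \<open>f R x\<close>.\<close>

lemma conv_f_upper:
  assumes "\<delta> > 0"
  shows "\<exists>R\<ge>1. \<forall>x. (\<integral>y. a (x - y) * f R y \<partial>lebesgue) \<le> (1 + \<delta>) * f R x"
proof (rule conv_f_le[OF assms, where K = "4 powr (\<alpha> - 1 / 2)"])
  fix \<delta>' :: real assume \<delta>': "\<delta>' > 0"
  let ?\<beta> = "\<alpha> - 1 / 2"
  \<comment> \<open>The value of \<open>L\<close> at which the constant of \<open>tail_le_f\<close>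
    equals \<open>\<delta>'\<close>.\<close>
  define L0 where "L0 = (\<delta>' * (2 * \<alpha> - 1) / c) powr (- 1 / ?\<beta>)"
  have L0: "L0 > 0" using \<delta>' alpha c_pos by (simp add: L0_def)
  have L0': "c / (2 * \<alpha> - 1) * L powr (- ?\<beta>) \<le> \<delta>'" if "L \<ge> L0" for L
  proof -
    have "L powr (- ?\<beta>) \<le> L0 powr (- ?\<beta>)"
      using that L0 beta by (intro powr_mono2') auto
    moreover have "- 1 / b * - b = 1" if "b > 0" for b :: real using that by simp
    from this[OF beta] have "- 1 / ?\<beta> * - ?\<beta> = 1" .
    then have "L0 powr (- ?\<beta>) = \<delta>' * (2 * \<alpha> - 1) / c"
      using \<delta>' alpha c_pos unfolding L0_def powr_powr by simp
    ultimately have "L powr (- ?\<beta>) \<le> \<delta>' * (2 * \<alpha> - 1) / c" by simp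
    then show ?thesis using alpha c_pos by (simp add: field_simps)
  qed
  have "\<exists>r. integrable lebesgue r \<and> (\<forall>y. r y \<ge> 0) \<and>
      (\<forall>y. A < \<bar>x - y\<bar> \<longrightarrow> a (x - y) * f R y \<le> 4 powr ?\<beta> * a (x - y) * f R x + r y) \<and>
      (\<integral>y. r y \<partial>lebesgue) \<le> \<delta>' * f R x"
    if A: "A \<ge> sqrt (2 * L0)" and R: "R \<ge> 2 * A" for A R x
  proof -
    have A0: "A > 0" using A L0 by (smt (verit) real_sqrt_gt_zero)
    have AL: "A\<^sup>2 / 2 \<ge> L0" using power_mono[OF A, of 2] L0 by simp
    have R0: "R > 0" using R A0 by simp
    define m where "m = max A (x / 2)"
    let ?r = "\<lambda>y. a (x - y) * indicator {m..} (x - y)"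
    have int: "integrable lebesgue ?r"
      by (rule integrable_lebesgue_reflect[of "\<lambda>z. a z * indicator {m..} z"])
        (auto intro: integrable_a_indicator)
    have pw: "a (x - y) * f R y \<le> 4 powr ?\<beta> * a (x - y) * f R x + ?r y"
      if y: "A < \<bar>x - y\<bar>" for y
    proof (cases "max x 0 \<le> 2 * max y 0")
      case True
      have "(max x 0 / R)\<^sup>2 \<le> (2 * (max y 0 / R))\<^sup>2"
        using True R0 by (intro power_mono) (auto simp: divide_right_mono)
      also have "\<dots> = 4 * (max y 0 / R)\<^sup>2" by (simp only: power_mult_distrib) simp
      finally have "1 + (max x 0 / R)\<^sup>2 \<le> 4 * (1 + (max y 0 / R)\<^sup>2)" by simp
      then have "f R y \<le> 4 powr ?\<beta> * f R x"
        by (intro f_comparable) auto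
      then have "a (x - y) * f R y \<le> a (x - y) * (4 powr ?\<beta> * f R x)"
        by (intro mult_left_mono a_nonneg)
      moreover have "0 \<le> ?r y" using a_nonneg[of "x - y"] by simp
      ultimately show ?thesis by (simp add: mult_ac)
    next
      case False
      then have "x - y \<ge> m" using y by (auto simp: m_def)
      then have "?r y = a (x - y)" by simp
      moreover have "a (x - y) * f R y \<le> a (x - y) * 1"
        by (intro mult_left_mono a_nonneg f_le_1)
      moreover have "0 \<le> 4 powr ?\<beta> * a (x - y) * f R x"
        using a_nonneg f_pos[of R x] by (simp add: less_imp_le)
      ultimately show ?thesis by linarith
    qed
    \<comment> \<open>Average of two lower bounds for \<open>m\<^sup>2\<close>: one is
      \<open>A\<^sup>2\<close>, the other is \<open>(max x 0 / 2)\<^sup>2\<close>, which dominates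
      \<open>(A * max x 0 / R)\<^sup>2\<close> because \<open>R \<ge> 2 * A\<close>.\<close>
    have "A\<^sup>2 / 2 * (1 + (max x 0 / R)\<^sup>2) \<le> m\<^sup>2"
    proof -
      have "m \<ge> A" "m \<ge> max x 0 / 2" using A0 by (auto simp: m_def)
      then have "m\<^sup>2 \<ge> A\<^sup>2" "m\<^sup>2 \<ge> (max x 0 / 2)\<^sup>2" using A0 by (auto intro!: power_mono)
      moreover have "(A * max x 0 / R)\<^sup>2 \<le> (max x 0 / 2)\<^sup>2"
      proof (rule power_mono)
        have "2 * A * max x 0 \<le> R * max x 0" using R by (intro mult_right_mono) auto
        then show "A * max x 0 / R \<le> max x 0 / 2" using R0 by (simp add: field_simps)
        show "0 \<le> A * max x 0 / R" using A0 R0 by simp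
      qed
      moreover have "A\<^sup>2 / 2 * (1 + (max x 0 / R)\<^sup>2) = A\<^sup>2 / 2 + (A * max x 0 / R)\<^sup>2 / 2"
        by (simp add: power_divide power_mult_distrib field_simps)
      ultimately show ?thesis by linarith
    qed
    then have "(\<integral>z. a z * indicator {m..} z \<partial>lebesgue)
        \<le> c / (2 * \<alpha> - 1) * (A\<^sup>2 / 2) powr (- ?\<beta>) * f R x"
      using A0 by (intro tail_le_f) (auto simp: m_def)
    also have "\<dots> \<le> \<delta>' * f R x"
      using L0'[OF AL] f_pos[of R x] by (intro mult_right_mono) auto
    also have "(\<integral>z. a z * indicator {m..} z \<partial>lebesgue) = (\<integral>y. ?r y \<partial>lebesgue)"
      by (rule integral_lebesgue_reflect[of "\<lambda>z. a z * indicator {m..} z", symmetric]) measurable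
    finally have "(\<integral>y. ?r y \<partial>lebesgue) \<le> \<delta>' * f R x" .
    then show ?thesis using pw int a_nonneg by (intro exI[of _ ?r]) auto
  qed
  then show "\<exists>A0. \<forall>A\<ge>A0. \<exists>R1. \<forall>R\<ge>R1. \<forall>x. \<exists>r. integrable lebesgue r \<and> (\<forall>y. r y \<ge> 0) \<and>
      (\<forall>y. A < \<bar>x - y\<bar> \<longrightarrow> a (x - y) * f R y \<le> 4 powr ?\<beta> * a (x - y) * f R x + r y) \<and>
      (\<integral>y. r y \<partial>lebesgue) \<le> \<delta>' * f R x"
    by blast
qed simp

text \<open>Turns the tail hypothesis on \<open>u0\<close> into the form that
  \<open>front_upper_bound\<close> expects. For \<open>x < 1\<close> the integral is at most 1 and
  the profile is bounded below.\<close>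

lemma tail_bounded_by_f:
  "\<exists>C>0. \<forall>x. (LINT y:{x..}|lebesgue. a y) \<le> C * f 1 x"
proof -
  let ?\<beta> = "\<alpha> - 1 / 2"
  have eq: "(LINT y:{x..}|lebesgue. a y) = (\<integral>z. a z * indicator {x..} z \<partial>lebesgue)" for x
    by (simp add: set_lebesgue_integral_def mult.commute)
  let ?C = "c / (2 * \<alpha> - 1) * (1 / 2) powr (- ?\<beta>) + 2 powr ?\<beta>"
  have C1: "c / (2 * \<alpha> - 1) * (1 / 2) powr (- ?\<beta>) > 0" using c_pos alpha by simp
  show ?thesis
  proof (intro exI[of _ ?C] conjI allI)
    show "?C > 0" using C1 by (simp add: add_pos_pos)
    fix x
    show "(LINT y:{x..}|lebesgue. a y) \<le> ?C * f 1 x"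
    proof (cases "x \<ge> 1")
      case True
      have "1 / 2 * (1 + (max x 0 / 1)\<^sup>2) \<le> x\<^sup>2"
        using True by (simp add: one_le_power)
      then have "(\<integral>z. a z * indicator {x..} z \<partial>lebesgue)
          \<le> c / (2 * \<alpha> - 1) * (1 / 2) powr (- ?\<beta>) * f 1 x"
        using True by (intro tail_le_f) auto
      also have "\<dots> \<le> ?C * f 1 x"
        using f_pos[of 1 x] by (intro mult_right_mono) auto
      finally show ?thesis unfolding eq .
    next
      case False
      have "(\<integral>z. a z * indicator {x..} z \<partial>lebesgue) \<le> (\<integral>z. a z \<partial>lebesgue)"
        by (intro Bochner_Integration.integral_mono integrable_a integrable_a_indicator)
          (auto simp: indicator_def a_nonneg)
      also have "\<dots> = 2 powr ?\<beta> * 2 powr (- ?\<beta>)"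
        by (simp add: integral_a powr_add[symmetric])
      also have "\<dots> \<le> ?C * f 1 x"
        using C1 False by (intro mult_mono f_ge) auto
      finally show ?thesis unfolding eq .
    qed
  qed
qed

text \<open>The interval \<open>{x - 2 * m..x - m}\<close> lies to the left of \<open>\<rho>\<close>
  and has length \<open>m\<close>, and the kernel is at least \<open>a (2 * m)\<close> on it. The
  product \<open>m * a (2 * m)\<close> is of order \<open>m powr (1 - 2 * \<alpha>)\<close>, the
  decay of the profile.\<close>

lemma conv_front_ge:
  assumes g: "g \<in> Linf" "AE y in lebesgue. 0 \<le> g y"
    and \<mu>: "\<mu> > 0" "AE y in lebesgue. y \<le> \<rho> \<longrightarrow> \<mu> \<le> g y"
  shows "\<exists>\<eta>>0. \<forall>x. \<eta> * f 1 x \<le> (\<integral>y. a (x - y) * g y \<partial>lebesgue)"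
proof -
  let ?\<beta> = "\<alpha> - 1 / 2"
  define q where "q = 2 * (1 + \<bar>\<rho>\<bar>)\<^sup>2"
  have q: "q > 0" by (simp add: q_def)
  show ?thesis
  proof (intro exI[of _ "\<mu> * (c * 5 powr (- \<alpha>) * q powr (- ?\<beta>))"] conjI allI)
    show "0 < \<mu> * (c * 5 powr (- \<alpha>) * q powr (- ?\<beta>))" using \<mu>(1) c_pos q by simp
    fix x
    \<comment> \<open>The maximum with 1 keeps \<open>m\<close> away from 0, so that
      \<open>1 + (2 * m)\<^sup>2 \<le> 5 * m\<^sup>2\<close>.\<close>
    define m where "m = max (x - \<rho>) 1"
    have m: "m \<ge> 1" "m \<ge> x - \<rho>" by (auto simp: m_def)
    have "m\<^sup>2 \<le> q * (1 + (max x 0 / 1)\<^sup>2)"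
    proof -
      have "m \<le> 1 + \<bar>\<rho>\<bar> + max x 0" by (auto simp: m_def)
      also have "\<dots> \<le> 1 + \<bar>\<rho>\<bar> + max x 0 + \<bar>\<rho>\<bar> * max x 0" by simp
      also have "\<dots> = (1 + \<bar>\<rho>\<bar>) * (1 + max x 0)" by (simp only: distrib_left distrib_right mult_1 mult_1_right ac_simps)
      finally have "m \<le> (1 + \<bar>\<rho>\<bar>) * (1 + max x 0)" .
      then have "m\<^sup>2 \<le> ((1 + \<bar>\<rho>\<bar>) * (1 + max x 0))\<^sup>2" using m by (intro power_mono) auto
      also have "\<dots> = (1 + \<bar>\<rho>\<bar>)\<^sup>2 * (1 + max x 0)\<^sup>2" by (rule power_mult_distrib)
      also have "\<dots> \<le> (1 + \<bar>\<rho>\<bar>)\<^sup>2 * (2 * (1 + (max x 0)\<^sup>2))"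
        using zero_le_power2[of "1 - max x 0"]
        by (intro mult_left_mono) (auto simp: power2_eq_square algebra_simps)
      finally show ?thesis by (simp add: q_def algebra_simps)
    qed
    then have "(q * (1 + (max x 0 / 1)\<^sup>2)) powr (- ?\<beta>) \<le> (m\<^sup>2) powr (- ?\<beta>)"
      using m beta by (intro powr_mono2') auto
    also have "\<dots> = m powr (1 - 2 * \<alpha>)" using m by (intro powr_exponent[symmetric]) simp
    finally have "q powr (- ?\<beta>) * f 1 x \<le> m powr (1 - 2 * \<alpha>)"
      by (simp add: f_def powr_mult)
    then have 1: "c * 5 powr (- \<alpha>) * (q powr (- ?\<beta>) * f 1 x) \<le> c * 5 powr (- \<alpha>) * m powr (1 - 2 * \<alpha>)"
      using c_pos by (intro mult_left_mono) auto
    have "1 \<le> m\<^sup>2" using m by (simp add: one_le_power)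
    then have 5: "(5 * m\<^sup>2) powr (- \<alpha>) \<le> (1 + \<bar>2 * m\<bar>\<^sup>2) powr (- \<alpha>)"
      using alpha by (intro powr_mono2') (auto simp: power_mult_distrib add_pos_nonneg)
    have m_powr: "m powr (1 - 2 * \<alpha>) = m * (m\<^sup>2) powr (- \<alpha>)"
    proof -
      have *: "m\<^sup>2 = m powr 2" using m by simp
      show ?thesis unfolding * powr_powr using m powr_add[of m 1 "- 2 * \<alpha>"] by simp
    qed
    have "c * 5 powr (- \<alpha>) * m powr (1 - 2 * \<alpha>) = c * m * (5 * m\<^sup>2) powr (- \<alpha>)"
      unfolding m_powr powr_mult by (simp only: mult_ac)
    also have "\<dots> \<le> c * m * (1 + \<bar>2 * m\<bar>\<^sup>2) powr (- \<alpha>)"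
      using 5 m c_pos by (intro mult_left_mono) auto
    also have "\<dots> = m * a (2 * m)" unfolding a_eq by simp
    finally have 2: "c * 5 powr (- \<alpha>) * m powr (1 - 2 * \<alpha>) \<le> m * a (2 * m)" .
    have "\<mu> * (c * 5 powr (- \<alpha>) * q powr (- ?\<beta>)) * f 1 x
        = \<mu> * (c * 5 powr (- \<alpha>) * (q powr (- ?\<beta>) * f 1 x))" by simp
    also have "\<dots> \<le> \<mu> * (m * a (2 * m))"
      using 1 2 \<mu>(1) by (intro mult_left_mono) auto
    also have "\<dots> = \<mu> * ((x - m) - (x - 2 * m)) * a (2 * m)" by simp
    also have "\<dots> \<le> (\<integral>y. a (x - y) * g y \<partial>lebesgue)"
    proof (rule conv_ge_interval[OF g])
      show "AE y in lebesgue. y \<in> {x - 2 * m..x - m} \<longrightarrow> \<mu> \<le> g y"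
        using \<mu>(2) by eventually_elim (use m in auto)
    qed (use \<mu> m in auto)
    finally show "\<mu> * (c * 5 powr (- \<alpha>) * q powr (- ?\<beta>)) * f 1 x
        \<le> (\<integral>y. a (x - y) * g y \<partial>lebesgue)" .
  qed
qed

end

section \<open>Both inclusions with a common threshold\<close>

theorem theorem2p8:
  fixes \<alpha> c :: real and a u0 :: "real \<Rightarrow> real" and u :: "real \<Rightarrow> real \<Rightarrow> real"
  assumes "\<alpha> > 1/2"
    and "\<And>x. a x = c * (1 + \<bar>x\<bar>\<^sup>2) powr (- \<alpha>)"
    and "(\<integral>x. a x \<partial>lebesgue) = 1"
    and "u0 \<in> Linf"
    and "AE x in lebesgue. 0 \<le> u0 x"
    and "classical_solution a u0 u"
  shows "\<forall>\<epsilon>\<in>{0<..<1::real}. \<forall>n\<ge>1::real. \<exists>\<tau>\<ge>0.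
    ((\<exists>C>0. AE x in lebesgue. u0 x \<le> C * a x) \<and>
     (\<exists>\<mu>>0. \<exists>x0. AE x in lebesgue. x \<in> {x0 - \<mu>..x0 + \<mu>} \<longrightarrow> \<mu> \<le> u0 x) \<longrightarrow>
     (\<forall>t\<ge>\<tau>. AE x in lebesgue. u t x \<in> {1/n..n} \<longrightarrow>
        exp ((1 - \<epsilon>) / (2 * \<alpha>) * t) \<le> \<bar>x\<bar> \<and> \<bar>x\<bar> \<le> exp ((1 + \<epsilon>) / (2 * \<alpha>) * t)))
    \<and>
    ((\<exists>C>0. AE x in lebesgue. u0 x \<le> C * (LINT y:{x..}|lebesgue. a y)) \<and>
     (\<exists>\<mu>>0. \<exists>\<rho>. AE x in lebesgue. x \<le> \<rho> \<longrightarrow> \<mu> \<le> u0 x) \<longrightarrow>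
     (\<forall>t\<ge>\<tau>. AE x in lebesgue. u t x \<in> {1/n..n} \<longrightarrow>
        exp ((1 - \<epsilon>) / (2 * \<alpha> - 1) * t) \<le> x \<and> x \<le> exp ((1 + \<epsilon>) / (2 * \<alpha> - 1) * t)))"
proof (intro ballI allI impI)
  fix \<epsilon> n :: real assume "\<epsilon> \<in> {0<..<1}" and "1 \<le> n"
  then have \<epsilon>: "0 < \<epsilon>" "\<epsilon> < 1" and n: "n > 0" by auto
  obtain u' where "AE_differentiable_curve 0 u u'"
    "\<And>t. t > 0 \<Longrightarrow> AE x in lebesgue. u' t x = min (\<integral>y. a (x - y) * u t y \<partial>lebesgue) 1"
    "\<And>t. t \<ge> 0 \<Longrightarrow> u t \<in> Linf" "AE x in lebesgue. u 0 x = u0 x"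
    using classical_solution_curve[OF assms(6)] by blast
  then interpret kernel_solution \<alpha> c a u0 u u'
    using assms by unfold_locales auto
  interpret abs: abs_profile \<alpha> c a
    using assms by unfold_locales auto
  interpret abs: profile_solution \<alpha> c a "\<lambda>x. \<bar>x\<bar>" \<alpha> u0 u u' ..
  interpret pos: positive_part_profile \<alpha> c a
    using assms by unfold_locales auto
  interpret pos: profile_solution \<alpha> c a "\<lambda>x. max x 0" "\<alpha> - 1 / 2" u0 u u' ..
  let ?H1 = "(\<exists>C>0. AE x in lebesgue. u0 x \<le> C * a x) \<and>
     (\<exists>\<mu>>0. \<exists>x0. AE x in lebesgue. x \<in> {x0 - \<mu>..x0 + \<mu>} \<longrightarrow> \<mu> \<le> u0 x)"
  let ?H2 = "(\<exists>C>0. AE x in lebesgue. u0 x \<le> C * (LINT y:{x..}|lebesgue. a y)) \<and>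
     (\<exists>\<mu>>0. \<exists>\<rho>. AE x in lebesgue. x \<le> \<rho> \<longrightarrow> \<mu> \<le> u0 x)"
  let ?P1 = "\<lambda>t. AE x in lebesgue. u t x \<in> {1/n..n} \<longrightarrow>
        exp ((1 - \<epsilon>) / (2 * \<alpha>) * t) \<le> \<bar>x\<bar> \<and> \<bar>x\<bar> \<le> exp ((1 + \<epsilon>) / (2 * \<alpha>) * t)"
  let ?P2 = "\<lambda>t. AE x in lebesgue. u t x \<in> {1/n..n} \<longrightarrow>
        exp ((1 - \<epsilon>) / (2 * \<alpha> - 1) * t) \<le> x \<and> x \<le> exp ((1 + \<epsilon>) / (2 * \<alpha> - 1) * t)"
  have 1: "\<exists>\<tau>\<ge>0. \<forall>t\<ge>\<tau>. ?P1 t" if H: ?H1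
  proof -
    obtain C \<mu> x0 where C: "AE x in lebesgue. u0 x \<le> C * a x"
      and \<mu>: "\<mu> > 0" "AE x in lebesgue. x \<in> {x0 - \<mu>..x0 + \<mu>} \<longrightarrow> \<mu> \<le> u0 x"
      using H by blast
    have "AE x in lebesgue. u0 x \<le> (C * c) * abs.f 1 x"
      using C c_pos by (simp add: abs.f_eq)
    from abs.front_upper_bound[OF abs.conv_f_upper this \<epsilon>(1) n]
    obtain \<tau>1 where \<tau>1: "\<tau>1 \<ge> 0" "\<forall>t\<ge>\<tau>1. AE x in lebesgue.
        1 / n \<le> u t x \<longrightarrow> \<bar>x\<bar> \<le> exp ((1 + \<epsilon>) / (2 * \<alpha>) * t)"
      by blast
    obtain \<eta> where "\<eta> > 0" "\<And>x. \<eta> * abs.f 1 x \<le> (\<integral>y. a (x - y) * u0 y \<partial>lebesgue)"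
      using abs.conv_bump_ge[OF assms(4,5) \<mu>] by blast
    from abs.front_lower_bound[OF this \<epsilon> n]
    obtain \<tau>2 where \<tau>2: "\<tau>2 \<ge> 0" "\<forall>t\<ge>\<tau>2. AE x in lebesgue.
        u t x \<le> n \<longrightarrow> exp ((1 - \<epsilon>) / (2 * \<alpha>) * t) \<le> \<bar>x\<bar>"
      by blast
    have "?P1 t" if "t \<ge> max \<tau>1 \<tau>2" for t
    proof -
      have "AE x in lebesgue. 1 / n \<le> u t x \<longrightarrow> \<bar>x\<bar> \<le> exp ((1 + \<epsilon>) / (2 * \<alpha>) * t)"
        "AE x in lebesgue. u t x \<le> n \<longrightarrow> exp ((1 - \<epsilon>) / (2 * \<alpha>) * t) \<le> \<bar>x\<bar>"
        using \<tau>1 \<tau>2 that by auto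
      then show ?thesis by eventually_elim auto
    qed
    then show ?thesis using \<tau>1(1) by (intro exI[of _ "max \<tau>1 \<tau>2"]) auto
  qed
  have two_beta: "2 * (\<alpha> - 1 / 2) = 2 * \<alpha> - 1" by simp
  have 2: "\<exists>\<tau>\<ge>0. \<forall>t\<ge>\<tau>. ?P2 t" if H: ?H2
  proof -
    obtain C \<mu> \<rho> where C: "C > 0" "AE x in lebesgue. u0 x \<le> C * (LINT y:{x..}|lebesgue. a y)"
      and \<mu>: "\<mu> > 0" "AE x in lebesgue. x \<le> \<rho> \<longrightarrow> \<mu> \<le> u0 x"
      using H by blast
    obtain C' where C': "\<And>x. (LINT y:{x..}|lebesgue. a y) \<le> C' * pos.f 1 x"
      using pos.tail_bounded_by_f by blast
    have "AE x in lebesgue. u0 x \<le> (C * C') * pos.f 1 x"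
      using C(2)
    proof eventually_elim
      case (elim x)
      have "C * (LINT y:{x..}|lebesgue. a y) \<le> C * (C' * pos.f 1 x)"
        using C(1) by (intro mult_left_mono C') auto
      with elim show ?case unfolding mult.assoc by (rule order_trans)
    qed
    from pos.front_upper_bound[OF pos.conv_f_upper this \<epsilon>(1) n, unfolded two_beta]
    obtain \<tau>1 where \<tau>1: "\<tau>1 \<ge> 0" "\<forall>t\<ge>\<tau>1. AE x in lebesgue.
        1 / n \<le> u t x \<longrightarrow> max x 0 \<le> exp ((1 + \<epsilon>) / (2 * \<alpha> - 1) * t)"
      by blast
    obtain \<eta> where "\<eta> > 0" "\<And>x. \<eta> * pos.f 1 x \<le> (\<integral>y. a (x - y) * u0 y \<partial>lebesgue)"
      using pos.conv_front_ge[OF assms(4,5) \<mu>] by blast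
    from pos.front_lower_bound[OF this \<epsilon> n, unfolded two_beta]
    obtain \<tau>2 where \<tau>2: "\<tau>2 \<ge> 0" "\<forall>t\<ge>\<tau>2. AE x in lebesgue.
        u t x \<le> n \<longrightarrow> exp ((1 - \<epsilon>) / (2 * \<alpha> - 1) * t) \<le> max x 0"
      by blast
    have "?P2 t" if "t \<ge> max \<tau>1 \<tau>2" for t
    proof -
      have "AE x in lebesgue. 1 / n \<le> u t x \<longrightarrow> max x 0 \<le> exp ((1 + \<epsilon>) / (2 * \<alpha> - 1) * t)"
        "AE x in lebesgue. u t x \<le> n \<longrightarrow> exp ((1 - \<epsilon>) / (2 * \<alpha> - 1) * t) \<le> max x 0"
        using \<tau>1 \<tau>2 that by auto
      then show ?thesis
      proof eventually_elim
        case (elim x)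
        \<comment> \<open>The lower bound for \<open>max x 0\<close> is positive, which forces
          \<open>x > 0\<close> and \<open>max x 0 = x\<close>.\<close>
        then show ?case using exp_gt_zero[of "(1 - \<epsilon>) / (2 * \<alpha> - 1) * t"]
          by (auto simp: max_def split: if_splits simp del: exp_gt_zero)
      qed
    qed
    then show ?thesis using \<tau>1(1) by (intro exI[of _ "max \<tau>1 \<tau>2"]) auto
  qed
  \<comment> \<open>\<open>\<tau>\<close> is chosen outside the two implications, so a threshold
    must exist even if \<open>?H1\<close> or \<open>?H2\<close> fails; then any nonnegative value
    serves.\<close>
  obtain \<tau>1 where "\<tau>1 \<ge> 0" "?H1 \<Longrightarrow> \<forall>t\<ge>\<tau>1. ?P1 t" using 1 by (cases ?H1) auto
  moreover obtain \<tau>2 where "\<tau>2 \<ge> 0" "?H2 \<Longrightarrow> \<forall>t\<ge>\<tau>2. ?P2 t" using 2 by (cases ?H2) auto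
  ultimately show "\<exists>\<tau>\<ge>0. (?H1 \<longrightarrow> (\<forall>t\<ge>\<tau>. ?P1 t)) \<and> (?H2 \<longrightarrow> (\<forall>t\<ge>\<tau>. ?P2 t))"
    by (intro exI[of _ "max \<tau>1 \<tau>2"]) auto
qed

end
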